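(* Let $x:M^n\to A^{n+1}$ be a locally strongly convex hypersurface in the affine space $A^{n+1}$. Then $x$ is an (equi)affine hypersphere if and only if it is among a family of equiaffine parallel affine hyperspheres of the same type.
   Context: $A^{n+1}$ is $\mathbb{R}^{n+1}$ with its canonical flat connection $d$ (componentwise differentiation) and the volume form $\mathrm{Vol}$ given by the determinant. A hypersurface is a smooth immersion $x:M^n\to A^{n+1}$ of a connected $n$-manifold. Indices $i,j,k,\dots$ run from $1$ to $n$. Affine invariants. For a local frame $\{e_1,\dots,e_n\}$ on $M$ write $x_i=e_i(x)$, $x_{ij}=e_j(e_i(x))$, $Y_i=e_i(Y)$, and choose a transversal field $e_{n+1}$ along $x$ with $\mathrm{Vol}(x_1,\dots,x_n,e_{n+1})=1$. Write $x_{ij}=\sum_k\Gamma_{ij}^k x_k+h_{ij}e_{n+1}$. The hypersurface is locally strongly convex if $(h_{ij})$ is definite everywhere; the orientation is then chosen so that $(h_{ij})$ is positive definite. With $H=|\det(h_{ij})|$, the Blaschke (affine) metric is $G=\sum G_{ij}\omega^i\omega^j$, $G_{ij}=H^{-1/(n+2)}h_{ij}$, where $\{\omega^i\}$ is the dual coframe (this does not depend on choices). The affine normal vector is $Y=\frac1n\Delta_G x$. The affine normal line at $u\in M$ is the line through $x(u)$ parallel to $Y(u)$. The affine shape operator $(B_i^j)$ is defined by $Y_i=-\sum_j B_i^j x_j$; its eigenvalues $\lambda_1,\dots,\lambda_n$ are the affine principal curvatures. Affine hyperspheres. A locally strongly convex hypersurface is an (equi)affine hypersphere if all of its affine principal curvatures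 are equal to one and the same constant $\lambda$; its type is elliptic if $\lambda>0$, parabolic if $\lambda=0$, hyperbolic if $\lambda<0$. Equiaffine parallel hypersurfaces. Let $x$ be locally strongly convex with affine normal $Y$ and let $\mu\in C^\infty(M)$. The hypersurface ${}^\mu x:=x+\mu Y$ is affine parallel to $x$ if ${}^\mu x$ is locally strongly convex and the tangent spaces ${}^\mu x_*(T_uM)$ and $x_*(T_uM)$ are parallel for all $u\in M$. It is equiaffine parallel to $x$ if it is affine parallel to $x$ and, in addition, the affine normal line of ${}^\mu x$ at $u$ is parallel to that of $x$ at $u$ for every $u\in M$. That $x$ is among a family of equiaffine parallel affine hyperspheres of the same type means: there is $\delta>0$ such that for every constant $\mu\in(-\delta,\delta)$ the hypersurface ${}^\mu x=x+\mu Y$ is equiaffine parallel to $x$ and is an affine hypersphere, all these hyperspheres being of the same type (all elliptic, all parabolic, or all hyperbolic). *)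

theory Defs
  imports "HOL-Analysis.Analysis"
begin

section \<open>Smooth maps between open subsets of Euclidean spaces\<close>

text \<open>For open \<open>S\<close> in a finite-dimensional space, \<open>Ck_on k S f\<close> is membership in $C^k(S)$:
  the directional derivatives in all constant directions are required to be $C^{k-1}$.\<close>

primrec Ck_on :: "nat \<Rightarrow> 'v::euclidean_space set \<Rightarrow> ('v \<Rightarrow> 'w::euclidean_space) \<Rightarrow> bool" where
  "Ck_on 0 S f \<longleftrightarrow> continuous_on S f"
| "Ck_on (Suc k) S f \<longleftrightarrow> (\<forall>p\<in>S. f differentiable (at p)) \<and>
     (\<forall>v. Ck_on k S (\<lambda>p. frechet_derivative f (at p) v))"

definition smooth_on :: "'v::euclidean_space set \<Rightarrow> ('v \<Rightarrow> 'w::euclidean_space) \<Rightarrow> bool" where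
  "smooth_on S f \<longleftrightarrow> (\<forall>k. Ck_on k S f)"


section \<open>Smooth manifolds\<close>

text \<open>A chart is a pair \<open>(U, \<phi>)\<close>; the values of \<open>\<phi>\<close> outside \<open>U\<close> are irrelevant.
  The dimension of the manifold is \<open>CARD('n)\<close>.\<close>

type_synonym ('a, 'n) chart = "'a set \<times> ('a \<Rightarrow> real^'n)"

abbreviation dom_chart :: "('a, 'n) chart \<Rightarrow> 'a set" where
  "dom_chart c \<equiv> fst c"

abbreviation inv_chart :: "('a, 'n) chart \<Rightarrow> real^'n \<Rightarrow> 'a" where
  "inv_chart c \<equiv> inv_into (fst c) (snd c)"

definition is_chart :: "'a topology \<Rightarrow> ('a, 'n::finite) chart \<Rightarrow> bool" where
  "is_chart M c \<longleftrightarrow> openin M (dom_chart c) \<and> open (snd c ` dom_chart c) \<and>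
     homeomorphic_map (subtopology M (dom_chart c)) (top_of_set (snd c ` dom_chart c)) (snd c)"

definition compatible :: "('a, 'n::finite) chart \<Rightarrow> ('a, 'n) chart \<Rightarrow> bool" where
  "compatible c d \<longleftrightarrow>
     smooth_on (snd c ` (dom_chart c \<inter> dom_chart d)) (snd d \<circ> inv_chart c) \<and>
     smooth_on (snd d ` (dom_chart c \<inter> dom_chart d)) (snd c \<circ> inv_chart d)"

definition smooth_manifold :: "'a topology \<Rightarrow> ('a, 'n::finite) chart set \<Rightarrow> bool" where
  "smooth_manifold M A \<longleftrightarrow> Hausdorff_space M \<and> second_countable M \<and>
     (\<forall>c\<in>A. is_chart M c) \<and> (\<Union>c\<in>A. dom_chart c) = topspace M \<and>
     (\<forall>c\<in>A. \<forall>d\<in>A. compatible c d)"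

text \<open>The maximal atlas generated by \<open>A\<close>.\<close>

definition charts :: "'a topology \<Rightarrow> ('a, 'n::finite) chart set \<Rightarrow> ('a, 'n) chart set" where
  "charts M A = {c. is_chart M c \<and> (\<forall>d\<in>A. compatible c d)}"

definition smooth_in_chart :: "('a, 'n::finite) chart \<Rightarrow> ('a \<Rightarrow> 'w::euclidean_space) \<Rightarrow> bool" where
  "smooth_in_chart c f \<longleftrightarrow> smooth_on (snd c ` dom_chart c) (f \<circ> inv_chart c)"

definition smooth_map ::
    "'a topology \<Rightarrow> ('a, 'n::finite) chart set \<Rightarrow> ('a \<Rightarrow> 'w::euclidean_space) \<Rightarrow> bool" where
  "smooth_map M A f \<longleftrightarrow> (\<forall>c \<in> charts M A. smooth_in_chart c f)"

text \<open>\<open>frame_deriv c i f\<close> is $e_i(f)$ for the coordinate frame $e_1,\dots,e_n$ of the chart \<open>c\<close>.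
  Local frames are coordinate frames of charts from the maximal atlas; every frame at a point
  is the value there of such a coordinate frame.\<close>

definition frame_deriv ::
    "('a, 'n::finite) chart \<Rightarrow> 'n \<Rightarrow> ('a \<Rightarrow> 'w::euclidean_space) \<Rightarrow> 'a \<Rightarrow> 'w" where
  "frame_deriv c i f u = frechet_derivative (f \<circ> inv_chart c) (at (snd c u)) (axis i 1)"


section \<open>Hypersurfaces in affine space\<close>

text \<open>The affine space $A^{n+1}$ is \<open>real^('n option)\<close>: the coordinates with index \<open>Some i\<close> are the
  first $n$ ones, the coordinate with index \<open>None\<close> is the last one.\<close>

definition Vol :: "('n::finite \<Rightarrow> real^('n option)) \<Rightarrow> real^('n option) \<Rightarrow> real" where
  "Vol X N = det (\<chi> k. case k of Some i \<Rightarrow> X i | None \<Rightarrow> N)"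

definition hypersurface ::
    "'a topology \<Rightarrow> ('a, 'n::finite) chart set \<Rightarrow> ('a \<Rightarrow> real^('n option)) \<Rightarrow> bool" where
  "hypersurface M A x \<longleftrightarrow> smooth_map M A x \<and>
     (\<forall>c \<in> charts M A. \<forall>u \<in> dom_chart c. inj (frechet_derivative (x \<circ> inv_chart c) (at (snd c u))))"

text \<open>\<open>N\<close> is a transversal field $e_{n+1}$ along \<open>x\<close> over the domain of \<open>c\<close> with
  $\mathrm{Vol}(x_1,\dots,x_n,e_{n+1})=1$.\<close>

definition unimodular_field ::
    "('a \<Rightarrow> real^('n::finite option)) \<Rightarrow> ('a, 'n) chart \<Rightarrow> ('a \<Rightarrow> real^('n option)) \<Rightarrow> bool" where
  "unimodular_field x c N \<longleftrightarrow> smooth_in_chart c N \<and>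
     (\<forall>u \<in> dom_chart c. Vol (\<lambda>i. frame_deriv c i x u) (N u) = 1)"

text \<open>$x_{ij}=e_j(e_i(x))=\sum_k\Gamma_{ij}^k x_k+h_{ij}e_{n+1}$.\<close>

definition second_form ::
    "('a \<Rightarrow> real^('n::finite option)) \<Rightarrow> ('a, 'n) chart \<Rightarrow> ('a \<Rightarrow> real^('n option)) \<Rightarrow> 'a \<Rightarrow> real^'n^'n"
where
  "second_form x c N u = (\<chi> i j. THE h. \<exists>\<Gamma> :: 'n \<Rightarrow> real.
     frame_deriv c j (frame_deriv c i x) u = (\<Sum>k\<in>UNIV. \<Gamma> k *\<^sub>R frame_deriv c k x u) + h *\<^sub>R N u)"

definition pos_def :: "real^'n^'n::finite \<Rightarrow> bool" where
  "pos_def Q \<longleftrightarrow> (\<forall>v. v \<noteq> 0 \<longrightarrow> v \<bullet> (Q *v v) > 0)"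

definition locally_strongly_convex ::
    "'a topology \<Rightarrow> ('a, 'n::finite) chart set \<Rightarrow> ('a \<Rightarrow> real^('n option)) \<Rightarrow> bool" where
  "locally_strongly_convex M A x \<longleftrightarrow> hypersurface M A x \<and>
     (\<forall>u \<in> topspace M. \<exists>c \<in> charts M A. \<exists>N. u \<in> dom_chart c \<and> unimodular_field x c N \<and>
        ((\<forall>w \<in> dom_chart c. pos_def (second_form x c N w)) \<or>
         (\<forall>w \<in> dom_chart c. pos_def (- second_form x c N w))))"

text \<open>A unimodular frame with the chosen orientation.\<close>

definition oriented_frame ::
    "'a topology \<Rightarrow> ('a, 'n::finite) chart set \<Rightarrow> ('a \<Rightarrow> real^('n option)) \<Rightarrow>
     ('a, 'n) chart \<Rightarrow> ('a \<Rightarrow> real^('n option)) \<Rightarrow> bool" where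
  "oriented_frame M A x c N \<longleftrightarrow> c \<in> charts M A \<and> unimodular_field x c N \<and>
     (\<forall>u \<in> dom_chart c. pos_def (second_form x c N u))"

definition blaschke_metric ::
    "('a \<Rightarrow> real^('n::finite option)) \<Rightarrow> ('a, 'n) chart \<Rightarrow> ('a \<Rightarrow> real^('n option)) \<Rightarrow> 'a \<Rightarrow> real^'n^'n"
where
  "blaschke_metric x c N u =
     (\<bar>det (second_form x c N u)\<bar> powr (- 1 / (real CARD('n) + 2))) *\<^sub>R second_form x c N u"

text \<open>The Laplace--Beltrami operator of a metric with coefficient matrix \<open>G\<close> in the chart \<open>c\<close>:
  $\Delta_G f=\frac1{\sqrt{\det G}}\sum_{i}\partial_i\bigl(\sqrt{\det G}\sum_j G^{ij}\partial_j f\bigr)$.\<close>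

definition laplacian ::
    "('a, 'n::finite) chart \<Rightarrow> ('a \<Rightarrow> real^'n^'n) \<Rightarrow> ('a \<Rightarrow> 'w::euclidean_space) \<Rightarrow> 'a \<Rightarrow> 'w" where
  "laplacian c G f u = (1 / sqrt (det (G u))) *\<^sub>R
     (\<Sum>i\<in>UNIV. frame_deriv c i
        (\<lambda>w. sqrt (det (G w)) *\<^sub>R (\<Sum>j\<in>UNIV. (matrix_inv (G w) $ i $ j) *\<^sub>R frame_deriv c j f w)) u)"

text \<open>\<open>Y\<close> is the affine normal vector field of \<open>x\<close>: it is given by $\frac1n\Delta_G x$ in every
  oriented frame. For locally strongly convex \<open>x\<close> the domains of these frames cover \<open>M\<close>,
  so \<open>Y\<close> is determined on \<open>topspace M\<close>.\<close>

definition affine_normal_field ::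
    "'a topology \<Rightarrow> ('a, 'n::finite) chart set \<Rightarrow> ('a \<Rightarrow> real^('n option)) \<Rightarrow>
     ('a \<Rightarrow> real^('n option)) \<Rightarrow> bool" where
  "affine_normal_field M A x Y \<longleftrightarrow>
     (\<forall>c N. oriented_frame M A x c N \<longrightarrow>
        (\<forall>u \<in> dom_chart c. Y u = (1 / real CARD('n)) *\<^sub>R laplacian c (blaschke_metric x c N) x u))"

definition affine_normal_line ::
    "('a \<Rightarrow> real^('n::finite option)) \<Rightarrow> ('a \<Rightarrow> real^('n option)) \<Rightarrow> 'a \<Rightarrow> (real^('n option)) set" where
  "affine_normal_line x Y u = {x u + t *\<^sub>R Y u | t. True}"

text \<open>\<open>B $ i $ j\<close> is $B_i^j$.\<close>

definition shape_operator ::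
    "('a, 'n::finite) chart \<Rightarrow> ('a \<Rightarrow> real^('n option)) \<Rightarrow> ('a \<Rightarrow> real^('n option)) \<Rightarrow> 'a \<Rightarrow>
     real^'n^'n \<Rightarrow> bool" where
  "shape_operator c x Y u B \<longleftrightarrow>
     (\<forall>i. frame_deriv c i Y u = - (\<Sum>j\<in>UNIV. (B $ i $ j) *\<^sub>R frame_deriv c j x u))"

definition principal_curvatures ::
    "('a, 'n::finite) chart \<Rightarrow> ('a \<Rightarrow> real^('n option)) \<Rightarrow> ('a \<Rightarrow> real^('n option)) \<Rightarrow> 'a \<Rightarrow> real set"
where
  "principal_curvatures c x Y u =
     {t. \<exists>B. shape_operator c x Y u B \<and> (\<exists>v. v \<noteq> 0 \<and> B *v v = t *\<^sub>R v)}"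


section \<open>Affine hyperspheres and equiaffine parallel hypersurfaces\<close>

definition affine_hypersphere_of ::
    "'a topology \<Rightarrow> ('a, 'n::finite) chart set \<Rightarrow> ('a \<Rightarrow> real^('n option)) \<Rightarrow> real \<Rightarrow> bool" where
  "affine_hypersphere_of M A x \<kappa> \<longleftrightarrow> locally_strongly_convex M A x \<and>
     (\<exists>Y. affine_normal_field M A x Y \<and>
        (\<forall>c \<in> charts M A. \<forall>u \<in> dom_chart c. principal_curvatures c x Y u = {\<kappa>}))"

definition affine_hypersphere ::
    "'a topology \<Rightarrow> ('a, 'n::finite) chart set \<Rightarrow> ('a \<Rightarrow> real^('n option)) \<Rightarrow> bool" where
  "affine_hypersphere M A x \<longleftrightarrow> (\<exists>\<kappa>. affine_hypersphere_of M A x \<kappa>)"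

definition elliptic_hypersphere ::
    "'a topology \<Rightarrow> ('a, 'n::finite) chart set \<Rightarrow> ('a \<Rightarrow> real^('n option)) \<Rightarrow> bool" where
  "elliptic_hypersphere M A x \<longleftrightarrow> (\<exists>\<kappa>>0. affine_hypersphere_of M A x \<kappa>)"

definition parabolic_hypersphere ::
    "'a topology \<Rightarrow> ('a, 'n::finite) chart set \<Rightarrow> ('a \<Rightarrow> real^('n option)) \<Rightarrow> bool" where
  "parabolic_hypersphere M A x \<longleftrightarrow> affine_hypersphere_of M A x 0"

definition hyperbolic_hypersphere ::
    "'a topology \<Rightarrow> ('a, 'n::finite) chart set \<Rightarrow> ('a \<Rightarrow> real^('n option)) \<Rightarrow> bool" where
  "hyperbolic_hypersphere M A x \<longleftrightarrow> (\<exists>\<kappa><0. affine_hypersphere_of M A x \<kappa>)"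

text \<open>$x_*(T_uM)$ as a linear subspace.\<close>

definition tangent_image ::
    "('a, 'n::finite) chart \<Rightarrow> ('a \<Rightarrow> real^('n option)) \<Rightarrow> 'a \<Rightarrow> (real^('n option)) set" where
  "tangent_image c x u = range (frechet_derivative (x \<circ> inv_chart c) (at (snd c u)))"

definition shifted ::
    "('a \<Rightarrow> real^('n::finite option)) \<Rightarrow> ('a \<Rightarrow> real^('n option)) \<Rightarrow> ('a \<Rightarrow> real) \<Rightarrow> 'a \<Rightarrow> real^('n option)"
where
  "shifted x Y \<mu> = (\<lambda>u. x u + \<mu> u *\<^sub>R Y u)"

text \<open>In the next two definitions \<open>Y\<close> is the affine normal of \<open>x\<close>. The library constant
  \<open>affine_parallel\<close> says that two sets are translates of each other.\<close>

definition affine_parallel_hypersurface ::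
    "'a topology \<Rightarrow> ('a, 'n::finite) chart set \<Rightarrow> ('a \<Rightarrow> real^('n option)) \<Rightarrow>
     ('a \<Rightarrow> real^('n option)) \<Rightarrow> ('a \<Rightarrow> real) \<Rightarrow> bool" where
  "affine_parallel_hypersurface M A x Y \<mu> \<longleftrightarrow> smooth_map M A \<mu> \<and>
     locally_strongly_convex M A (shifted x Y \<mu>) \<and>
     (\<forall>c \<in> charts M A. \<forall>u \<in> dom_chart c.
        affine_parallel (tangent_image c (shifted x Y \<mu>) u) (tangent_image c x u))"

definition equiaffine_parallel_hypersurface ::
    "'a topology \<Rightarrow> ('a, 'n::finite) chart set \<Rightarrow> ('a \<Rightarrow> real^('n option)) \<Rightarrow>
     ('a \<Rightarrow> real^('n option)) \<Rightarrow> ('a \<Rightarrow> real) \<Rightarrow> bool" where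
  "equiaffine_parallel_hypersurface M A x Y \<mu> \<longleftrightarrow> affine_parallel_hypersurface M A x Y \<mu> \<and>
     (\<exists>Y'. affine_normal_field M A (shifted x Y \<mu>) Y' \<and>
        (\<forall>u \<in> topspace M.
           affine_parallel (affine_normal_line (shifted x Y \<mu>) Y' u) (affine_normal_line x Y u)))"

definition in_equiaffine_parallel_family ::
    "'a topology \<Rightarrow> ('a, 'n::finite) chart set \<Rightarrow> ('a \<Rightarrow> real^('n option)) \<Rightarrow> bool" where
  "in_equiaffine_parallel_family M A x \<longleftrightarrow>
     (\<exists>Y. affine_normal_field M A x Y \<and>
       (\<exists>\<delta>>0. (\<forall>\<mu>\<in>{-\<delta><..<\<delta>}. equiaffine_parallel_hypersurface M A x Y (\<lambda>_. \<mu>)) \<and>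
         ((\<forall>\<mu>\<in>{-\<delta><..<\<delta>}. elliptic_hypersphere M A (shifted x Y (\<lambda>_. \<mu>))) \<or>
          (\<forall>\<mu>\<in>{-\<delta><..<\<delta>}. parabolic_hypersphere M A (shifted x Y (\<lambda>_. \<mu>))) \<or>
          (\<forall>\<mu>\<in>{-\<delta><..<\<delta>}. hyperbolic_hypersphere M A (shifted x Y (\<lambda>_. \<mu>))))))"

end

(* The backward implication is the member mu = 0 of the family.

   Conversely let all affine principal curvatures of x be kappa. In an oriented frame let nu be the
   conormal, nu(w) = Vol(x_1, ..., x_n, w), so that h_ij = nu(x_ij). The existence of principal
   curvatures makes every Y_i tangent; differentiating nu(Y_i) = 0 gives nu(Y_ij) = - sum_k B_ik h_kj,
   and since mixed partial derivatives commute, B is self-adjoint for the positive definite form h.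
   Having kappa as its only eigenvalue, B is kappa times the identity, that is dY = - kappa dx.

   Hence x' = x + mu Y satisfies dx' = s dx with s = 1 - mu kappa, which is positive for small mu.
   Then h' = s^(n+1) h, the Blaschke metrics are proportional with a constant factor a > 0, and
   Y' = (1/n) Delta_G' x' = (s/a) Y is parallel to Y. So x' has the single principal curvature
   kappa/a, which has the sign of kappa. *)

theory Submission
  imports Defs
begin

section \<open>Calculus of smooth maps\<close>

lemma frechet_derivative_eventually_eq:
  fixes f g :: "'v::euclidean_space \<Rightarrow> 'w::euclidean_space"
  assumes "open S" "p \<in> S" "\<And>q. q \<in> S \<Longrightarrow> f q = g q"
  shows "frechet_derivative f (at p) = frechet_derivative g (at p)"
proof -
  have "(f has_derivative F) (at p) \<longleftrightarrow> (g has_derivative F) (at p)" for F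
    using assms has_derivative_transform_within_open[of f F p UNIV S g]
      has_derivative_transform_within_open[of g F p UNIV S f] by auto
  then show ?thesis unfolding frechet_derivative_def by simp
qed

lemma differentiable_eventually_eq:
  fixes f g :: "'v::euclidean_space \<Rightarrow> 'w::euclidean_space"
  assumes "open S" "p \<in> S" "\<And>q. q \<in> S \<Longrightarrow> f q = g q" "f differentiable (at p)"
  shows "g differentiable (at p)"
  using assms has_derivative_transform_within_open[of f _ p UNIV S g] unfolding differentiable_def by auto

lemma Ck_on_cong:
  assumes "open S" "\<And>q. q \<in> S \<Longrightarrow> f q = g q" "Ck_on k S f"
  shows "Ck_on k S g"
  using assms
proof (induction k arbitrary: f g)
  case 0
  then show ?case by (metis Ck_on.simps(1) continuous_on_eq)
next
  case (Suc k)
  have "Ck_on k S (\<lambda>p. frechet_derivative g (at p) v)" for v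
  proof (rule Suc.IH[OF \<open>open S\<close>])
    show "frechet_derivative f (at q) v = frechet_derivative g (at q) v" if "q \<in> S" for q
      using frechet_derivative_eventually_eq[OF \<open>open S\<close> that Suc.prems(2)] by simp
    show "Ck_on k S (\<lambda>p. frechet_derivative f (at p) v)" using Suc.prems by simp
  qed
  moreover have "g differentiable (at p)" if "p \<in> S" for p
    using differentiable_eventually_eq[OF \<open>open S\<close> that Suc.prems(2)] Suc.prems(3) that by simp
  ultimately show ?case by simp
qed

lemma Ck_on_Suc_imp_continuous: "Ck_on (Suc k) S f \<Longrightarrow> continuous_on S f"
  by (auto intro!: differentiable_imp_continuous_on simp: differentiable_on_def differentiable_at_withinI)

lemma Ck_on_SucD: "Ck_on (Suc k) S f \<Longrightarrow> Ck_on k S f"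
proof (induction k arbitrary: f)
  case 0
  then show ?case unfolding Ck_on.simps(1) by (rule Ck_on_Suc_imp_continuous)
qed simp

lemma Ck_on_SucI:
  assumes "open S" "\<And>p. p \<in> S \<Longrightarrow> (f has_derivative f' p) (at p)" "\<And>v. Ck_on k S (\<lambda>p. f' p v)"
  shows "Ck_on (Suc k) S f"
proof -
  have "f' p v = frechet_derivative f (at p) v" if "p \<in> S" for p v
    using frechet_derivative_at[OF assms(2)[OF that]] by simp
  then have "Ck_on k S (\<lambda>p. frechet_derivative f (at p) v)" for v
    by (intro Ck_on_cong[OF assms(1) _ assms(3)]) simp
  then show ?thesis using assms(2) by (auto simp: differentiable_def)
qed

lemma Ck_on_Suc_has_derivative:
  "Ck_on (Suc k) S f \<Longrightarrow> p \<in> S \<Longrightarrow> (f has_derivative frechet_derivative f (at p)) (at p)"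
  by (simp add: frechet_derivative_works)

lemma Ck_on_const: "Ck_on k S (\<lambda>p. c)"
  by (induction k arbitrary: c) simp_all

lemma Ck_on_bounded_linear:
  assumes "bounded_linear L" "open S"
  shows "Ck_on k S f \<Longrightarrow> Ck_on k S (\<lambda>p. L (f p))"
proof (induction k arbitrary: f)
  case 0
  then show ?case using bounded_linear.continuous_on[OF assms(1)] by simp
next
  case (Suc k)
  show ?case
  proof (rule Ck_on_SucI[OF \<open>open S\<close>])
    show "((\<lambda>p. L (f p)) has_derivative (\<lambda>v. L (frechet_derivative f (at p) v))) (at p)" if "p \<in> S" for p
      by (rule bounded_linear.has_derivative[OF assms(1) Ck_on_Suc_has_derivative[OF Suc.prems that]])
    show "Ck_on k S (\<lambda>p. L (frechet_derivative f (at p) v))" for v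
      using Suc by simp
  qed
qed

lemma Ck_on_add:
  assumes "open S"
  shows "Ck_on k S f \<Longrightarrow> Ck_on k S g \<Longrightarrow> Ck_on k S (\<lambda>p. f p + g p)"
proof (induction k arbitrary: f g)
  case 0
  then show ?case by (simp add: continuous_on_add)
next
  case (Suc k)
  show ?case
  proof (rule Ck_on_SucI[OF \<open>open S\<close>])
    show "((\<lambda>p. f p + g p) has_derivative
        (\<lambda>v. frechet_derivative f (at p) v + frechet_derivative g (at p) v)) (at p)" if "p \<in> S" for p
      using Suc.prems that by (intro has_derivative_add Ck_on_Suc_has_derivative)
    show "Ck_on k S (\<lambda>p. frechet_derivative f (at p) v + frechet_derivative g (at p) v)" for v
      using Suc by simp
  qed
qed

lemma Ck_on_sum:
  assumes "open S" "\<And>i. i \<in> I \<Longrightarrow> Ck_on k S (f i)"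
  shows "Ck_on k S (\<lambda>p. \<Sum>i\<in>I. f i p)"
  using assms(2)
  by (induction I rule: infinite_finite_induct) (auto intro: Ck_on_const Ck_on_add[OF assms(1)])

lemma Ck_on_bilinear:
  assumes "bounded_bilinear B" "open S"
  shows "Ck_on k S f \<Longrightarrow> Ck_on k S g \<Longrightarrow> Ck_on k S (\<lambda>p. B (f p) (g p))"
proof (induction k arbitrary: f g)
  case 0
  then show ?case using bounded_bilinear.continuous_on[OF assms(1)] by simp
next
  case (Suc k)
  show ?case
  proof (rule Ck_on_SucI[OF \<open>open S\<close>])
    show "((\<lambda>p. B (f p) (g p)) has_derivative
        (\<lambda>v. B (f p) (frechet_derivative g (at p) v) + B (frechet_derivative f (at p) v) (g p))) (at p)"
      if "p \<in> S" for p
      using Suc.prems that by (intro bounded_bilinear.FDERIV[OF assms(1)] Ck_on_Suc_has_derivative)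
    show "Ck_on k S (\<lambda>p. B (f p) (frechet_derivative g (at p) v) + B (frechet_derivative f (at p) v) (g p))" for v
      using Suc.prems(1,2)[THEN Ck_on_SucD] Suc.prems by (intro Ck_on_add[OF assms(2)] Suc.IH) auto
  qed
qed

lemmas Ck_on_mult = Ck_on_bilinear[OF bounded_bilinear_mult]
lemmas Ck_on_scaleR = Ck_on_bilinear[OF bounded_bilinear_scaleR]

lemma Ck_on_prod:
  fixes f :: "'i \<Rightarrow> 'v::euclidean_space \<Rightarrow> real"
  assumes "open S" "\<And>i. i \<in> I \<Longrightarrow> Ck_on k S (f i)"
  shows "Ck_on k S (\<lambda>p. \<Prod>i\<in>I. f i p)"
  using assms(2)
proof (induction I rule: infinite_finite_induct)
  case (insert i I)
  then show ?case by (simp add: Ck_on_mult[OF assms(1)])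
qed (simp_all add: Ck_on_const)

lemma Ck_on_compose:
  assumes "open S" "open T" "g ` S \<subseteq> T"
  shows "Ck_on k T f \<Longrightarrow> Ck_on k S g \<Longrightarrow> Ck_on k S (\<lambda>p. f (g p))"
proof (induction k arbitrary: f)
  case 0
  then show ?case using assms continuous_on_compose2[of T f S g] by simp
next
  case (Suc k)
  let ?F = "\<lambda>p v. \<Sum>b\<in>Basis. (frechet_derivative g (at p) v \<bullet> b) *\<^sub>R frechet_derivative f (at (g p)) b"
  show ?case
  proof (rule Ck_on_SucI[OF \<open>open S\<close>])
    fix p assume p: "p \<in> S"
    then have fd: "(f has_derivative frechet_derivative f (at (g p))) (at (g p))"
      using Ck_on_Suc_has_derivative[OF Suc.prems(1)] assms(3) by blast
    have gd: "(g has_derivative frechet_derivative g (at p)) (at p)"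
      using Suc.prems(2) p by (rule Ck_on_Suc_has_derivative)
    interpret L: linear "frechet_derivative f (at (g p))"
      using fd has_derivative_linear by blast
    have expand: "frechet_derivative f (at (g p)) w = (\<Sum>b\<in>Basis. (w \<bullet> b) *\<^sub>R frechet_derivative f (at (g p)) b)" for w
    proof -
      have "frechet_derivative f (at (g p)) w = frechet_derivative f (at (g p)) (\<Sum>b\<in>Basis. (w \<bullet> b) *\<^sub>R b)"
        by (simp only: euclidean_representation)
      also have "\<dots> = (\<Sum>b\<in>Basis. (w \<bullet> b) *\<^sub>R frechet_derivative f (at (g p)) b)"
        by (simp only: L.sum L.scale)
      finally show ?thesis .
    qed
    have "?F p = frechet_derivative f (at (g p)) \<circ> frechet_derivative g (at p)"
      unfolding comp_def by (intro ext) (rule expand[symmetric])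
    then have "((f \<circ> g) has_derivative ?F p) (at p)"
      using diff_chain_at[OF gd fd] by (simp only:)
    then show "((\<lambda>p. f (g p)) has_derivative ?F p) (at p)"
      by (simp only: comp_def)
  next
    fix v
    show "Ck_on k S (\<lambda>p. ?F p v)"
    proof (intro Ck_on_sum Ck_on_scaleR assms)
      fix b :: 'b
      have "Ck_on k S (\<lambda>p. frechet_derivative g (at p) v)" using Suc.prems by simp
      then show "Ck_on k S (\<lambda>p. frechet_derivative g (at p) v \<bullet> b)"
        by (rule Ck_on_bounded_linear[OF bounded_linear_inner_left assms(1)])
      show "Ck_on k S (\<lambda>p. frechet_derivative f (at (g p)) b)"
        by (rule Suc.IH[OF _ Ck_on_SucD[OF Suc.prems(2)]]) (use Suc.prems(1) in simp)
    qed
  qed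
qed

lemma Ck_on_linear:
  assumes "bounded_linear L" "open S"
  shows "Ck_on k S L"
proof -
  have "Ck_on k S (\<lambda>p::'a. p)"
  proof (cases k)
    case (Suc j)
    show ?thesis unfolding Suc
      by (rule Ck_on_SucI[OF assms(2), where f'="\<lambda>p v. v"]) (auto intro: Ck_on_const)
  qed simp
  then show ?thesis by (rule Ck_on_bounded_linear[OF assms])
qed

lemma Ck_on_powr:
  "Ck_on k {0<..} (\<lambda>t::real. t powr a)"
proof (induction k arbitrary: a)
  case 0
  then show ?case by (auto intro!: continuous_intros)
next
  case (Suc k)
  show ?case
  proof (rule Ck_on_SucI)
    show "((\<lambda>t. t powr a) has_derivative (\<lambda>v. (a * t powr (a - 1)) * v)) (at t)" if "t \<in> {0<..}" for t :: real
      using has_real_derivative_powr[of t a] that by (simp add: has_field_derivative_def)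
    show "Ck_on k {0<..} (\<lambda>t::real. a * t powr (a - 1) * v)" for v
      by (intro Ck_on_mult Ck_on_const Suc) auto
  qed auto
qed

lemma smooth_on_powr:
  fixes f :: "'v::euclidean_space \<Rightarrow> real"
  assumes "open S" "smooth_on S f" "\<And>p. p \<in> S \<Longrightarrow> f p > 0"
  shows "smooth_on S (\<lambda>p. f p powr a)"
  unfolding smooth_on_def
proof
  fix k
  show "Ck_on k S (\<lambda>p. f p powr a)"
    by (rule Ck_on_compose[where f = "\<lambda>t. t powr a", OF assms(1) _ _ Ck_on_powr])
      (use assms in \<open>auto simp: smooth_on_def\<close>)
qed

lemma smooth_on_cong:
  assumes "open S" "\<And>q. q \<in> S \<Longrightarrow> f q = g q" "smooth_on S f"
  shows "smooth_on S g"
  using assms(3) unfolding smooth_on_def by (auto intro: Ck_on_cong[OF assms(1,2)])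

lemma smooth_on_differentiable: "smooth_on S f \<Longrightarrow> p \<in> S \<Longrightarrow> f differentiable (at p)"
  unfolding smooth_on_def by (drule spec[of _ "Suc 0"]) simp

lemma smooth_on_frechet_derivative:
  assumes "smooth_on S f" shows "smooth_on S (\<lambda>p. frechet_derivative f (at p) v)"
  unfolding smooth_on_def
proof
  show "Ck_on k S (\<lambda>p. frechet_derivative f (at p) v)" for k
    using assms[unfolded smooth_on_def, THEN spec, of "Suc k"] by simp
qed

lemma smooth_on_const: "smooth_on S (\<lambda>p. c)"
  unfolding smooth_on_def by (intro allI Ck_on_const)

lemma smooth_on_linear: "bounded_linear L \<Longrightarrow> open S \<Longrightarrow> smooth_on S L"
  unfolding smooth_on_def by (rule allI, rule Ck_on_linear) auto

lemma smooth_on_bounded_linear: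
  "bounded_linear L \<Longrightarrow> open S \<Longrightarrow> smooth_on S f \<Longrightarrow> smooth_on S (\<lambda>p. L (f p))"
  unfolding smooth_on_def by (rule allI, rule Ck_on_bounded_linear) auto

lemma smooth_on_bilinear:
  "bounded_bilinear B \<Longrightarrow> open S \<Longrightarrow> smooth_on S f \<Longrightarrow> smooth_on S g \<Longrightarrow> smooth_on S (\<lambda>p. B (f p) (g p))"
  unfolding smooth_on_def by (rule allI, rule Ck_on_bilinear) auto

lemmas smooth_on_mult = smooth_on_bilinear[OF bounded_bilinear_mult]
lemmas smooth_on_scaleR = smooth_on_bilinear[OF bounded_bilinear_scaleR]
lemmas smooth_on_inner = smooth_on_bilinear[OF bounded_bilinear_inner]

lemma smooth_on_sum:
  "open S \<Longrightarrow> (\<And>i. i \<in> I \<Longrightarrow> smooth_on S (f i)) \<Longrightarrow> smooth_on S (\<lambda>p. \<Sum>i\<in>I. f i p)"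
  unfolding smooth_on_def by (rule allI, rule Ck_on_sum) auto

lemma smooth_on_prod:
  fixes f :: "'i \<Rightarrow> 'v::euclidean_space \<Rightarrow> real"
  shows "open S \<Longrightarrow> (\<And>i. i \<in> I \<Longrightarrow> smooth_on S (f i)) \<Longrightarrow> smooth_on S (\<lambda>p. \<Prod>i\<in>I. f i p)"
  unfolding smooth_on_def by (rule allI, rule Ck_on_prod) auto

lemma smooth_on_compose:
  assumes "open S" "open T" "g ` S \<subseteq> T" "smooth_on T f" "smooth_on S g"
  shows "smooth_on S (\<lambda>p. f (g p))"
  unfolding smooth_on_def
  by (rule allI, rule Ck_on_compose[OF assms(1-3)]) (use assms(4,5) in \<open>simp_all add: smooth_on_def\<close>)

lemma smooth_on_det:
  fixes F :: "'v::euclidean_space \<Rightarrow> real^'m^'m"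
  assumes "open S" "\<And>i j. smooth_on S (\<lambda>p. F p $ i $ j)"
  shows "smooth_on S (\<lambda>p. det (F p))"
  unfolding det_def by (intro smooth_on_sum smooth_on_mult smooth_on_const smooth_on_prod assms)

lemma smooth_on_vec:
  fixes f :: "'v::euclidean_space \<Rightarrow> real^'m"
  assumes "open S" "\<And>i. smooth_on S (\<lambda>p. f p $ i)"
  shows "smooth_on S f"
proof (rule smooth_on_cong[OF assms(1)])
  show "(\<Sum>i\<in>UNIV. f p $ i *\<^sub>R axis i (1::real)) = f p" for p
    by (simp add: vec_eq_iff axis_def if_distrib cong: if_cong)
  show "smooth_on S (\<lambda>p. \<Sum>i\<in>UNIV. f p $ i *\<^sub>R axis i (1::real))"
    by (intro smooth_on_sum smooth_on_scaleR smooth_on_const assms)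
qed

lemma smooth_on_vec_nth: "open S \<Longrightarrow> smooth_on S (f :: _ \<Rightarrow> real^'m) \<Longrightarrow> smooth_on S (\<lambda>p. f p $ i)"
  by (rule smooth_on_bounded_linear[OF bounded_linear_vec_nth])

section \<open>Mixed partial derivatives\<close>

text \<open>Mean value theorem twice: the second difference of \<open>f\<close> over a small parallelogram spanned by
  \<open>v\<close> and \<open>w\<close> is a value of the mixed derivative nearby.\<close>

lemma second_difference_mvt:
  fixes f :: "'v::euclidean_space \<Rightarrow> real"
  assumes "Ck_on 2 S f" "ball p r \<subseteq> S" "h > 0" "h * (norm v + norm w) < r"
  obtains q where "q \<in> ball p r"
    "f (p + h *\<^sub>R v + h *\<^sub>R w) - f (p + h *\<^sub>R v) - f (p + h *\<^sub>R w) + f p =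
      h * h * frechet_derivative (\<lambda>q. frechet_derivative f (at q) v) (at q) w"
proof -
  let ?D = "\<lambda>q. frechet_derivative f (at q) v"
  have in_ball: "p + s *\<^sub>R v + t *\<^sub>R w \<in> ball p r" if "0 \<le> s" "s \<le> h" "0 \<le> t" "t \<le> h" for s t
  proof -
    have "norm (s *\<^sub>R v + t *\<^sub>R w) \<le> s * norm v + t * norm w"
      using norm_triangle_ineq[of "s *\<^sub>R v" "t *\<^sub>R w"] that by simp
    also have "\<dots> \<le> h * norm v + h * norm w"
      using that by (intro add_mono mult_right_mono) auto
    finally have "norm (s *\<^sub>R v + t *\<^sub>R w) < r"
      using assms(4) by (simp add: distrib_left)
    moreover have "dist p (p + s *\<^sub>R v + t *\<^sub>R w) = norm (s *\<^sub>R v + t *\<^sub>R w)"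
      by (metis add.assoc add_diff_cancel_left' dist_commute dist_norm)
    ultimately show ?thesis by simp
  qed
  have fd: "(f has_derivative frechet_derivative f (at q)) (at q)" if "q \<in> ball p r" for q
    using assms(1,2) that Ck_on_Suc_has_derivative[of 1 S f q] by (auto simp: numeral_2_eq_2)
  have Dd: "(?D has_derivative frechet_derivative ?D (at q)) (at q)" if "q \<in> ball p r" for q
    using assms(1,2) that Ck_on_Suc_has_derivative[of 0 S ?D q] by (auto simp: numeral_2_eq_2)
  have line: "((\<lambda>t. g (a + t *\<^sub>R u)) has_real_derivative g' u) (at t)"
    if g: "(g has_derivative g') (at (a + t *\<^sub>R u))" for g :: "'v \<Rightarrow> real" and g' a u t
  proof -
    have "((\<lambda>t. a + t *\<^sub>R u) has_derivative (\<lambda>t. t *\<^sub>R u)) (at t)"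
      by (auto intro!: derivative_eq_intros)
    from diff_chain_at[OF this g] have "((\<lambda>t. g (a + t *\<^sub>R u)) has_derivative (\<lambda>s. g' (s *\<^sub>R u))) (at t)"
      by (simp add: comp_def)
    moreover have "g' (s *\<^sub>R u) = g' u * s" for s
      using linear_cmul[OF has_derivative_linear[OF g], of s u] by simp
    ultimately show ?thesis by (simp add: has_field_derivative_def)
  qed
  define \<phi> where "\<phi> s = f ((p + h *\<^sub>R w) + s *\<^sub>R v) - f (p + s *\<^sub>R v)" for s
  have "(\<phi> has_real_derivative ?D ((p + h *\<^sub>R w) + s *\<^sub>R v) - ?D (p + s *\<^sub>R v)) (at s)"
    if "0 \<le> s" "s \<le> h" for s
    unfolding \<phi>_def
    using in_ball[of s h] in_ball[of s 0] that assms(3)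
    by (intro DERIV_diff line fd) (auto simp: add_ac)
  from MVT2[OF assms(3) this] obtain s where s: "0 < s" "s < h"
    and "\<phi> h - \<phi> 0 = (h - 0) * (?D ((p + h *\<^sub>R w) + s *\<^sub>R v) - ?D (p + s *\<^sub>R v))"
    by blast
  then have eq1: "\<phi> h - \<phi> 0 = h * (?D ((p + s *\<^sub>R v) + h *\<^sub>R w) - ?D ((p + s *\<^sub>R v) + 0 *\<^sub>R w))"
    by (simp add: add_ac)
  have "((\<lambda>t. ?D ((p + s *\<^sub>R v) + t *\<^sub>R w)) has_real_derivative
      frechet_derivative ?D (at ((p + s *\<^sub>R v) + t *\<^sub>R w)) w) (at t)" if "0 \<le> t" "t \<le> h" for t
    using in_ball[of s t] that s by (intro line Dd) auto
  from MVT2[OF assms(3) this] obtain t where t: "0 < t" "t < h" and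
    "?D ((p + s *\<^sub>R v) + h *\<^sub>R w) - ?D ((p + s *\<^sub>R v) + 0 *\<^sub>R w) =
      (h - 0) * frechet_derivative ?D (at ((p + s *\<^sub>R v) + t *\<^sub>R w)) w"
    by blast
  with eq1 have "\<phi> h - \<phi> 0 = h * h * frechet_derivative ?D (at (p + s *\<^sub>R v + t *\<^sub>R w)) w"
    by simp
  then show thesis
    using in_ball[of s t] s t by (intro that) (auto simp: \<phi>_def algebra_simps)
qed

lemma mixed_partials_real:
  fixes f :: "'v::euclidean_space \<Rightarrow> real"
  assumes "open S" "p \<in> S" "Ck_on 2 S f"
  shows "frechet_derivative (\<lambda>q. frechet_derivative f (at q) v) (at p) w =
    frechet_derivative (\<lambda>q. frechet_derivative f (at q) w) (at p) v" (is "?F p = ?G p")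
proof (rule ccontr)
  assume neq: "?F p \<noteq> ?G p"
  define e where "e = \<bar>?F p - ?G p\<bar> / 2"
  have e: "e > 0" using neq by (simp add: e_def)
  have "continuous_on S ?F" "continuous_on S ?G"
    using assms(3) by (auto simp: numeral_2_eq_2)
  then have "isCont ?F p" "isCont ?G p"
    using assms(1,2) continuous_on_eq_continuous_at by blast+
  then obtain r1 r2 where r: "r1 > 0" "r2 > 0"
    and "\<And>q. dist q p < r1 \<Longrightarrow> dist (?F q) (?F p) < e" "\<And>q. dist q p < r2 \<Longrightarrow> dist (?G q) (?G p) < e"
    using e unfolding continuous_at_eps_delta by metis
  obtain r3 where r3: "r3 > 0" "ball p r3 \<subseteq> S"
    using assms(1,2) open_contains_ball by blast
  define r where "r = min r1 (min r2 r3)"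
  have rpos: "r > 0" and sub: "ball p r \<subseteq> S"
    using r r3 by (auto simp: r_def)
  have F: "\<bar>?F q - ?F p\<bar> < e" and G: "\<bar>?G q - ?G p\<bar> < e" if "q \<in> ball p r" for q
    using that \<open>\<And>q. dist q p < r1 \<Longrightarrow> dist (?F q) (?F p) < e\<close> \<open>\<And>q. dist q p < r2 \<Longrightarrow> dist (?G q) (?G p) < e\<close>
    by (auto simp: r_def dist_real_def dist_commute)
  define h where "h = r / (norm v + norm w + 1)"
  have h: "h > 0" "h * (norm v + norm w) < r"
    using rpos by (auto simp: h_def field_simps add_pos_nonneg add_nonneg_pos intro: add_nonneg_pos)
  obtain q1 where q1: "q1 \<in> ball p r"
    "f (p + h *\<^sub>R v + h *\<^sub>R w) - f (p + h *\<^sub>R v) - f (p + h *\<^sub>R w) + f p = h * h * ?F q1"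
    using second_difference_mvt[OF assms(3) sub h] by metis
  have h': "h * (norm w + norm v) < r" using h(2) by (simp add: add.commute)
  obtain q2 where q2: "q2 \<in> ball p r"
    "f (p + h *\<^sub>R w + h *\<^sub>R v) - f (p + h *\<^sub>R w) - f (p + h *\<^sub>R v) + f p = h * h * ?G q2"
    using second_difference_mvt[OF assms(3) sub h(1) h'] by metis
  have "f (p + h *\<^sub>R v + h *\<^sub>R w) = f (p + h *\<^sub>R w + h *\<^sub>R v)" by (simp add: add_ac)
  then have "h * h * ?F q1 = h * h * ?G q2" using q1(2) q2(2) by linarith
  then have "?F q1 = ?G q2" using h(1) by simp
  then have "\<bar>?F p - ?G p\<bar> < 2 * e" using F[OF q1(1)] G[OF q2(1)] by linarith
  then show False by (simp add: e_def)
qed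

lemma frechet_derivative_bounded_linear:
  assumes "bounded_linear L" "f differentiable (at p)"
  shows "frechet_derivative (\<lambda>q. L (f q)) (at p) v = L (frechet_derivative f (at p) v)"
  using frechet_derivative_at[OF bounded_linear.has_derivative[OF assms(1)
        frechet_derivative_works[THEN iffD1, OF assms(2)]]] by (rule fun_cong[symmetric])

lemma frechet_derivative_bilinear:
  assumes "bounded_bilinear B" "f differentiable (at p)" "g differentiable (at p)"
  shows "frechet_derivative (\<lambda>q. B (f q) (g q)) (at p) v =
    B (f p) (frechet_derivative g (at p) v) + B (frechet_derivative f (at p) v) (g p)"
  using frechet_derivative_at[OF bounded_bilinear.FDERIV[OF assms(1)
        frechet_derivative_works[THEN iffD1, OF assms(2)] frechet_derivative_works[THEN iffD1, OF assms(3)]]]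
  by (rule fun_cong[symmetric])

lemma mixed_partials:
  fixes f :: "'v::euclidean_space \<Rightarrow> 'w::euclidean_space"
  assumes "open S" "p \<in> S" "smooth_on S f"
  shows "frechet_derivative (\<lambda>q. frechet_derivative f (at q) v) (at p) w =
    frechet_derivative (\<lambda>q. frechet_derivative f (at q) w) (at p) v"
proof (rule euclidean_eqI)
  fix b :: 'w assume "b \<in> Basis"
  let ?fb = "\<lambda>q. f q \<bullet> b"
  have L: "bounded_linear (\<lambda>y. y \<bullet> b)" by (rule bounded_linear_inner_left)
  have first: "frechet_derivative ?fb (at q) u = frechet_derivative f (at q) u \<bullet> b" if "q \<in> S" for q u
    using frechet_derivative_bounded_linear[OF L smooth_on_differentiable[OF assms(3) that]] .
  have second: "frechet_derivative (\<lambda>q. frechet_derivative ?fb (at q) u) (at p) u' =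
      frechet_derivative (\<lambda>q. frechet_derivative f (at q) u) (at p) u' \<bullet> b" for u u'
  proof -
    have "frechet_derivative (\<lambda>q. frechet_derivative ?fb (at q) u) (at p) =
        frechet_derivative (\<lambda>q. frechet_derivative f (at q) u \<bullet> b) (at p)"
      by (rule frechet_derivative_eventually_eq[OF assms(1,2)]) (rule first)
    then show ?thesis
      using frechet_derivative_bounded_linear[OF L
          smooth_on_differentiable[OF smooth_on_frechet_derivative[OF assms(3)] assms(2)]] by simp
  qed
  have "smooth_on S ?fb" by (rule smooth_on_bounded_linear[OF L assms(1,3)])
  then have "Ck_on 2 S ?fb" by (simp add: smooth_on_def)
  from mixed_partials_real[OF assms(1,2) this, of v w]
  show "frechet_derivative (\<lambda>q. frechet_derivative f (at q) v) (at p) w \<bullet> b =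
    frechet_derivative (\<lambda>q. frechet_derivative f (at q) w) (at p) v \<bullet> b"
    unfolding second .
qed

section \<open>Definite matrices\<close>

lemma matrix_inv_works:
  fixes A :: "real^'n^'n"
  assumes "det A \<noteq> 0"
  shows "A ** matrix_inv A = mat 1" "matrix_inv A ** A = mat 1"
proof -
  have "\<exists>A'. A ** A' = mat 1 \<and> A' ** A = mat 1"
    using assms invertible_det_nz unfolding invertible_def by blast
  from someI_ex[OF this] show "A ** matrix_inv A = mat 1" "matrix_inv A ** A = mat 1"
    unfolding matrix_inv_def by auto
qed

lemma matrix_inv_eqI:
  fixes A :: "real^'n^'n"
  assumes "A ** B = mat 1"
  shows "matrix_inv A = B"
proof -
  have "det A * det B = 1" using assms det_mul[of A B] by simp
  then have "det A \<noteq> 0" by auto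
  then have "matrix_inv A ** A = mat 1" by (rule matrix_inv_works)
  then show ?thesis by (metis assms matrix_mul_assoc matrix_mul_lid matrix_mul_rid)
qed

lemma matrix_inv_scaleR:
  fixes A :: "real^'n^'n"
  assumes "det A \<noteq> 0" "a \<noteq> 0"
  shows "matrix_inv (a *\<^sub>R A) = (1 / a) *\<^sub>R matrix_inv A"
  using assms matrix_inv_works[OF assms(1)]
  by (intro matrix_inv_eqI) (simp add: scalar_matrix_assoc[symmetric] matrix_scalar_ac)

lemma matrix_inv_cramer:
  fixes A :: "real^'n^'n"
  assumes "det A \<noteq> 0"
  shows "matrix_inv A $ i $ j = det (\<chi> r s. if s = i then axis j 1 $ r else A $ r $ s) / det A"
proof -
  have "A *v (matrix_inv A *v axis j 1) = axis j 1"
    using matrix_inv_works(1)[OF assms] by (simp add: matrix_vector_mul_assoc)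
  then have "matrix_inv A *v axis j 1 = (\<chi> k. det (\<chi> r s. if s = k then axis j 1 $ r else A $ r $ s) / det A)"
    using cramer[OF assms] by blast
  then show ?thesis by (metis (no_types, lifting) matrix_vector_mul_component vec_lambda_beta column_def matrix_vector_mult_basis)
qed

lemma det_scaleR:
  fixes A :: "real^'n^'n"
  shows "det (a *\<^sub>R A) = a ^ CARD('n) * det A"
  using det_rows_mul[of "\<lambda>_. a" "\<lambda>i. A $ i"]
  by (simp add: vector_scalar_mult_def scaleR_vec_def)

lemma pos_def_det_pos:
  fixes Q :: "real^'n^'n"
  assumes "pos_def Q"
  shows "det Q > 0"
proof (rule ccontr)
  assume "\<not> det Q > 0"
  define P where "P t = (1 - t) *\<^sub>R mat 1 + t *\<^sub>R Q" for t
  have nz: "det (P t) \<noteq> 0" if "0 \<le> t" "t \<le> 1" for t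
  proof
    assume "det (P t) = 0"
    then obtain v where v: "v \<noteq> 0" "P t *v v = 0"
      using invertible_det_nz[of "P t"] matrix_left_invertible_ker[of "P t"] invertible_left_inverse by blast
    have "v \<bullet> (P t *v v) = (1 - t) * (v \<bullet> v) + t * (v \<bullet> (Q *v v))"
      by (simp add: P_def matrix_vector_mult_add_rdistrib scaleR_matrix_vector_assoc[symmetric] inner_right_distrib)
    moreover have "v \<bullet> v > 0" "v \<bullet> (Q *v v) > 0"
      using v(1) assms by (auto simp: pos_def_def)
    then have "(1 - t) * (v \<bullet> v) + t * (v \<bullet> (Q *v v)) > 0"
      using that by (cases "t = 0") (auto intro: add_nonneg_pos)
    ultimately show False using v(2) by simp
  qed
  have "continuous_on {0..1} (\<lambda>t. det (P t))"
    unfolding det_def P_def by (auto intro!: continuous_intros)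
  moreover have "det (P 0) = 1" "det (P 1) = det Q" by (simp_all add: P_def)
  ultimately have "\<exists>t\<ge>0. t \<le> 1 \<and> det (P t) = 0"
    using IVT2'[of "\<lambda>t. det (P t)" 1 0 0] \<open>\<not> det Q > 0\<close> by auto
  then show False using nz by blast
qed

lemma symmetric_inner:
  fixes S :: "real^'n^'n"
  assumes "transpose S = S"
  shows "v \<bullet> (S *v w) = w \<bullet> (S *v v)"
  by (metis assms dot_lmul_matrix inner_commute transpose_matrix_vector)

lemma psd_null_vector:
  fixes Q :: "real^'n^'n"
  assumes "transpose Q = Q" "\<And>w. w \<bullet> (Q *v w) \<ge> 0" "v \<bullet> (Q *v v) = 0"
  shows "Q *v v = 0"
proof -
  define w where "w = Q *v v"
  define a where "a = w \<bullet> w"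
  define c where "c = w \<bullet> (Q *v w)"
  have c: "c \<ge> 0" using assms(2) by (simp add: c_def)
  define u where "u = a / (c + 1)"
  have a: "a = u * (c + 1)" using c by (simp add: u_def)
  have "0 \<le> (v - u *\<^sub>R w) \<bullet> (Q *v (v - u *\<^sub>R w))" by (rule assms)
  also have "\<dots> = u * u * c - 2 * u * a"
    using assms(3) symmetric_inner[OF assms(1), of v w]
    by (simp add: matrix_vector_mult_diff_distrib matrix_vector_mult_scaleR inner_diff_left inner_diff_right
        a_def c_def w_def[symmetric] inner_commute algebra_simps)
  also have "\<dots> = - (u\<^sup>2 * (c + 2))"
    by (simp add: a algebra_simps power2_eq_square)
  finally have "u\<^sup>2 * (c + 2) \<le> 0" by simp
  then have "u = 0" using c by (simp add: mult_le_0_iff)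
  then have "a = 0" using a by simp
  then show ?thesis by (simp add: a_def w_def)
qed

lemma rayleigh_maximum:
  fixes h S :: "real^'n^'n"
  assumes h: "pos_def h" "transpose h = h" and S: "transpose S = S"
  obtains \<kappa> v where "v \<noteq> 0" "S *v v = \<kappa> *\<^sub>R (h *v v)" "\<And>w. w \<bullet> (S *v w) \<le> \<kappa> * (w \<bullet> (h *v w))"
proof -
  let ?f = "\<lambda>w. (w \<bullet> (S *v w)) / (w \<bullet> (h *v w))"
  have hpos: "w \<bullet> (h *v w) > 0" if "w \<noteq> 0" for w
    using h(1) that by (simp add: pos_def_def)
  have nz: "w \<bullet> (h *v w) \<noteq> 0" if "w \<in> sphere 0 1" for w
    using hpos[of w] that by (cases "w = 0") auto
  have "continuous_on (sphere 0 1) ?f"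
    by (intro continuous_intros linear_continuous_on matrix_vector_mul_bounded_linear) (use nz in auto)
  moreover have "sphere (0::real^'n) 1 \<noteq> {}" by simp
  ultimately obtain v where v: "v \<in> sphere 0 1" and max: "\<And>w. w \<in> sphere 0 1 \<Longrightarrow> ?f w \<le> ?f v"
    using continuous_attains_sup[of "sphere (0::real^'n) 1" ?f] compact_sphere by blast
  define \<kappa> where "\<kappa> = ?f v"
  have le: "w \<bullet> (S *v w) \<le> \<kappa> * (w \<bullet> (h *v w))" for w
  proof (cases "w = 0")
    case False
    define u where "u = (1 / norm w) *\<^sub>R w"
    have "u \<in> sphere 0 1" using False by (simp add: u_def)
    then have "?f u \<le> \<kappa>" using max by (simp add: \<kappa>_def)
    moreover have "?f u = ?f w"
      using False by (simp add: u_def matrix_vector_mult_scaleR)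
    ultimately show ?thesis using hpos[OF False] by (simp add: divide_le_eq)
  qed simp
  define Q where "Q = \<kappa> *\<^sub>R h - S"
  have Qv: "Q *v w = \<kappa> *\<^sub>R (h *v w) - S *v w" for w
    by (simp add: Q_def matrix_vector_mult_diff_rdistrib scaleR_matrix_vector_assoc)
  have "transpose Q = Q"
    using h(2) S by (simp add: Q_def transpose_def vec_eq_iff)
  moreover have "v \<bullet> (Q *v v) = 0"
    using nz[OF v] by (simp add: Qv inner_diff_right \<kappa>_def)
  ultimately have "Q *v v = 0"
    using le by (intro psd_null_vector) (auto simp: Qv inner_diff_right)
  then have "S *v v = \<kappa> *\<^sub>R (h *v v)" by (simp add: Qv)
  moreover have "v \<noteq> 0" using v by auto
  ultimately show thesis using le by (intro that)
qed

text \<open>Symmetry of \<open>B ** h\<close> says that \<open>transpose B\<close> is self-adjoint for the inner product \<open>h\<close>.\<close>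

lemma self_adjoint_single_eigenvalue:
  fixes h B :: "real^'n^'n"
  assumes h: "pos_def h" "transpose h = h" and B: "transpose (B ** h) = B ** h"
    and eig: "\<And>t v. v \<noteq> 0 \<Longrightarrow> B *v v = t *\<^sub>R v \<Longrightarrow> t = \<kappa>"
  shows "B = \<kappa> *\<^sub>R mat 1"
proof -
  have hnz: "h *v v \<noteq> 0" if "v \<noteq> 0" for v
    using h(1) that by (auto simp: pos_def_def)
  have gen: "t = \<kappa>" if "v \<noteq> 0" "(B ** h) *v v = t *\<^sub>R (h *v v)" for t v
    using eig[OF hnz[OF that(1)]] that(2) by (simp add: matrix_vector_mul_assoc)
  have upper: "w \<bullet> ((B ** h) *v w) \<le> \<kappa> * (w \<bullet> (h *v w))" for w
    using rayleigh_maximum[OF h B] gen by metis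
  have neg: "transpose (- (B ** h)) = - (B ** h)"
    using B by (simp add: transpose_def vec_eq_iff)
  have minus: "(- (B ** h)) *v w = - ((B ** h) *v w)" for w
    by (simp add: matrix_vector_mult_def vec_eq_iff sum_negf)
  have lower: "\<kappa> * (w \<bullet> (h *v w)) \<le> w \<bullet> ((B ** h) *v w)" for w
  proof -
    obtain t v where "v \<noteq> 0" "(- (B ** h)) *v v = t *\<^sub>R (h *v v)"
      and le: "\<And>w. w \<bullet> ((- (B ** h)) *v w) \<le> t * (w \<bullet> (h *v w))"
      using rayleigh_maximum[OF h neg] by metis
    then have "(B ** h) *v v = (- t) *\<^sub>R (h *v v)" unfolding minus by (metis minus_minus scaleR_minus_left)
    then have "- t = \<kappa>" using gen \<open>v \<noteq> 0\<close> by blast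
    then have "t = - \<kappa>" by simp
    then show ?thesis using le[of w] unfolding minus by simp
  qed
  define Q where "Q = B ** h - \<kappa> *\<^sub>R h"
  have Qv: "Q *v w = (B ** h) *v w - \<kappa> *\<^sub>R (h *v w)" for w
    by (simp add: Q_def matrix_vector_mult_diff_rdistrib scaleR_matrix_vector_assoc)
  have "transpose Q = Q"
    using h(2) B by (simp add: Q_def transpose_def vec_eq_iff)
  moreover have "w \<bullet> (Q *v w) = 0" for w
    using upper[of w] lower[of w] by (simp add: Qv inner_diff_right)
  ultimately have "Q *v w = 0" for w
    by (intro psd_null_vector) auto
  then have "(B ** h) *v w = (\<kappa> *\<^sub>R h) *v w" for w
    by (simp add: Qv scaleR_matrix_vector_assoc)
  then have eq: "B ** h = \<kappa> *\<^sub>R h" by (simp add: matrix_eq)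
  have inv: "h ** matrix_inv h = mat 1"
    using pos_def_det_pos[OF h(1)] by (intro matrix_inv_works) simp
  have "B = (B ** h) ** matrix_inv h"
    by (simp add: matrix_mul_assoc[symmetric] inv)
  also have "\<dots> = \<kappa> *\<^sub>R mat 1"
    by (simp add: eq scalar_matrix_assoc[symmetric] inv)
  finally show ?thesis .
qed

section \<open>Charts and coordinate frames\<close>

lemma is_chart_inj: "is_chart M c \<Longrightarrow> inj_on (snd c) (fst c)"
  unfolding is_chart_def homeomorphic_map_def
  using openin_subset[of M "fst c"] by (auto simp: Int_absorb1)

lemma is_chart_open_overlap:
  assumes "is_chart M c" "is_chart M d"
  shows "open (snd c ` (fst c \<inter> fst d))"
proof -
  have hom: "homeomorphic_map (subtopology M (fst c)) (top_of_set (snd c ` fst c)) (snd c)"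
    and o: "openin M (fst c)" "openin M (fst d)" and op: "open (snd c ` fst c)"
    using assms by (auto simp: is_chart_def)
  have "fst c \<inter> fst d \<subseteq> topspace (subtopology M (fst c))"
    using openin_subset[OF o(1)] by auto
  moreover have "openin (subtopology M (fst c)) (fst c \<inter> fst d)"
    using o by (metis inf_commute openin_subtopology_Int)
  ultimately have "openin (top_of_set (snd c ` fst c)) (snd c ` (fst c \<inter> fst d))"
    using homeomorphic_map_openness[OF hom] by blast
  then show ?thesis using op openin_open_trans by blast
qed

locale coordinate_chart =
  fixes c :: "('a, 'n::finite) chart"
  assumes open_image: "open (snd c ` fst c)" and inj: "inj_on (snd c) (fst c)"
begin

abbreviation S where "S \<equiv> snd c ` fst c"

lemma inv_chart_snd [simp]: "u \<in> fst c \<Longrightarrow> inv_chart c (snd c u) = u"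
  using inj by (rule inv_into_f_f)

lemma smooth_in_chart_cong:
  assumes "\<And>u. u \<in> fst c \<Longrightarrow> f u = g u" "smooth_in_chart c f"
  shows "smooth_in_chart c g"
  using assms(2) unfolding smooth_in_chart_def
  by (rule smooth_on_cong[OF open_image, rotated]) (auto simp: assms(1))

lemma differentiable_in_chart:
  "smooth_in_chart c f \<Longrightarrow> u \<in> fst c \<Longrightarrow> (f \<circ> inv_chart c) differentiable (at (snd c u))"
  unfolding smooth_in_chart_def by (rule smooth_on_differentiable) auto

lemma frame_deriv_cong:
  assumes "\<And>w. w \<in> fst c \<Longrightarrow> f w = g w" "u \<in> fst c"
  shows "frame_deriv c i f u = frame_deriv c i g u"
  unfolding frame_deriv_def
  by (rule fun_cong[OF frechet_derivative_eventually_eq[OF open_image]]) (use assms in auto)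

lemma smooth_frame_deriv:
  assumes "smooth_in_chart c f"
  shows "smooth_in_chart c (frame_deriv c i f)"
  unfolding smooth_in_chart_def
proof (rule smooth_on_cong[OF open_image])
  show "smooth_on S (\<lambda>p. frechet_derivative (f \<circ> inv_chart c) (at p) (axis i 1))"
    using assms unfolding smooth_in_chart_def by (rule smooth_on_frechet_derivative)
qed (auto simp: frame_deriv_def)

lemma frame_deriv_scaleR:
  assumes "smooth_in_chart c f" "u \<in> fst c"
  shows "frame_deriv c i (\<lambda>w. a *\<^sub>R f w) u = a *\<^sub>R frame_deriv c i f u"
  using frechet_derivative_bounded_linear[OF bounded_linear_scaleR_right[of a] differentiable_in_chart[OF assms]]
  by (simp add: frame_deriv_def comp_def)

lemma frame_deriv_inner:
  assumes "smooth_in_chart c f" "smooth_in_chart c g" "u \<in> fst c"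
  shows "frame_deriv c i (\<lambda>w. f w \<bullet> g w) u = f u \<bullet> frame_deriv c i g u + frame_deriv c i f u \<bullet> g u"
  using frechet_derivative_bilinear[OF bounded_bilinear_inner differentiable_in_chart[OF assms(1,3)]
      differentiable_in_chart[OF assms(2,3)]] assms(3)
  by (simp add: frame_deriv_def comp_def)

lemma frame_deriv_const: "frame_deriv c i (\<lambda>w. k) u = 0"
  by (simp add: frame_deriv_def comp_def)

lemma frame_deriv_commute:
  assumes "smooth_in_chart c f" "u \<in> fst c"
  shows "frame_deriv c j (frame_deriv c i f) u = frame_deriv c i (frame_deriv c j f) u"
proof -
  let ?f = "f \<circ> inv_chart c"
  have eq: "frame_deriv c k (frame_deriv c l f) u =
      frechet_derivative (\<lambda>q. frechet_derivative ?f (at q) (axis l 1)) (at (snd c u)) (axis k 1)" for k l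
    unfolding frame_deriv_def[of c k]
    by (rule fun_cong[OF frechet_derivative_eventually_eq[OF open_image]])
      (use assms(2) in \<open>auto simp: frame_deriv_def\<close>)
  show ?thesis unfolding eq
    using assms by (intro mixed_partials[OF open_image]) (auto simp: smooth_in_chart_def)
qed

lemma frechet_derivative_frame:
  assumes "(f \<circ> inv_chart c) differentiable (at (snd c u))"
  shows "frechet_derivative (f \<circ> inv_chart c) (at (snd c u)) v = (\<Sum>i\<in>UNIV. v $ i *\<^sub>R frame_deriv c i f u)"
proof -
  interpret L: linear "frechet_derivative (f \<circ> inv_chart c) (at (snd c u))"
    using assms by (rule linear_frechet_derivative)
  have "v = (\<Sum>i\<in>UNIV. v $ i *\<^sub>R axis i (1::real))"
    by (simp add: vec_eq_iff axis_def if_distrib cong: if_cong)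
  then have "frechet_derivative (f \<circ> inv_chart c) (at (snd c u)) v =
      frechet_derivative (f \<circ> inv_chart c) (at (snd c u)) (\<Sum>i\<in>UNIV. v $ i *\<^sub>R axis i (1::real))"
    by simp
  also have "\<dots> = (\<Sum>i\<in>UNIV. v $ i *\<^sub>R frame_deriv c i f u)"
    by (simp only: L.sum L.scale frame_deriv_def)
  finally show ?thesis .
qed

end

lemma is_chart_coordinate_chart: "is_chart M c \<Longrightarrow> coordinate_chart c"
  using is_chart_inj[of M c] by (simp add: coordinate_chart_def is_chart_def)

lemma charts_is_chart: "c \<in> charts M A \<Longrightarrow> is_chart M c"
  by (simp add: charts_def)

lemma charts_coordinate_chart: "c \<in> charts M A \<Longrightarrow> coordinate_chart c"
  by (rule is_chart_coordinate_chart[OF charts_is_chart])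

text \<open>Two charts of the maximal atlas need only be compared near one point, through a chart of \<open>A\<close>.\<close>

lemma transition_differentiable:
  assumes M: "smooth_manifold M A" and c: "c \<in> charts M A" and d: "d \<in> charts M A"
    and u: "u \<in> fst c" "u \<in> fst d"
  shows "(snd d \<circ> inv_chart c) differentiable (at (snd c u))"
proof -
  interpret c: coordinate_chart c using c by (rule charts_coordinate_chart)
  have "u \<in> topspace M"
    using charts_is_chart[OF c] u(1) openin_subset unfolding is_chart_def by blast
  then obtain a where a: "a \<in> A" "u \<in> fst a"
    using M unfolding smooth_manifold_def by blast
  then have "is_chart M a" using M unfolding smooth_manifold_def by blast
  then interpret a: coordinate_chart a by (rule is_chart_coordinate_chart)
  have ca: "smooth_on (snd c ` (fst c \<inter> fst a)) (snd a \<circ> inv_chart c)"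
    and ad: "smooth_on (snd a ` (fst d \<inter> fst a)) (snd d \<circ> inv_chart a)"
    using c d a(1) unfolding charts_def compatible_def by auto
  have "(snd a \<circ> inv_chart c) differentiable (at (snd c u))"
    using ca by (rule smooth_on_differentiable) (use u a in auto)
  moreover have "(snd d \<circ> inv_chart a) differentiable (at ((snd a \<circ> inv_chart c) (snd c u)))"
    using ad by (rule smooth_on_differentiable) (use u a in auto)
  ultimately have diff: "((snd d \<circ> inv_chart a) \<circ> (snd a \<circ> inv_chart c)) differentiable (at (snd c u))"
    by (rule differentiable_chain_at)
  show ?thesis
  proof (rule differentiable_eventually_eq[OF is_chart_open_overlap _ _ diff])
    show "is_chart M c" "is_chart M a" by (fact charts_is_chart[OF c] \<open>is_chart M a\<close>)+
    show "snd c u \<in> snd c ` (fst c \<inter> fst a)" using u a by blast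
  qed auto
qed

lemma frechet_derivative_change_chart:
  assumes M: "smooth_manifold M A" and c: "c \<in> charts M A" and d: "d \<in> charts M A"
    and u: "u \<in> fst c" "u \<in> fst d" and f: "((f \<circ> inv_chart d) has_derivative f') (at (snd d u))"
  shows "((f \<circ> inv_chart c) has_derivative
    (f' \<circ> frechet_derivative (snd d \<circ> inv_chart c) (at (snd c u)))) (at (snd c u))"
proof -
  interpret c: coordinate_chart c using c by (rule charts_coordinate_chart)
  interpret d: coordinate_chart d using d by (rule charts_coordinate_chart)
  have t: "((snd d \<circ> inv_chart c) has_derivative frechet_derivative (snd d \<circ> inv_chart c) (at (snd c u))) (at (snd c u))"
    using transition_differentiable[OF assms(1-5)] by (simp add: frechet_derivative_works)
  have f': "((f \<circ> inv_chart d) has_derivative f') (at ((snd d \<circ> inv_chart c) (snd c u)))"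
    using f u by simp
  show ?thesis
  proof (rule has_derivative_transform_within_open[OF diff_chain_at[OF t f']])
    show "open (snd c ` (fst c \<inter> fst d))"
      using is_chart_open_overlap charts_is_chart c d by blast
  qed (use u in auto)
qed

definition reflection :: "'n \<Rightarrow> real^'n \<Rightarrow> real^'n" where
  "reflection a v = (\<chi> i. if i = a then - v $ i else v $ i)"

definition reflect_chart :: "'n \<Rightarrow> ('a, 'n::finite) chart \<Rightarrow> ('a, 'n) chart" where
  "reflect_chart a c = (fst c, reflection a \<circ> snd c)"

lemma reflection_reflection [simp]: "reflection a (reflection a v) = v"
  by (simp add: reflection_def vec_eq_iff)

lemma reflection_eq_iff: "reflection a v = w \<longleftrightarrow> v = reflection a w"
  by (metis reflection_reflection)

lemma bounded_linear_reflection: "bounded_linear (reflection a)"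
  unfolding linear_conv_bounded_linear[symmetric]
  by (auto intro!: linearI simp: reflection_def vec_eq_iff)

lemma reflection_image: "reflection a ` T = reflection a -` T"
  by (auto simp: image_iff) (metis reflection_reflection)

lemma open_reflection_image: "open T \<Longrightarrow> open (reflection a ` T)"
  unfolding reflection_image
  by (intro open_vimage linear_continuous_on bounded_linear_reflection)

lemma fst_reflect_chart [simp]: "fst (reflect_chart a c) = fst c"
  by (simp add: reflect_chart_def)

lemma snd_reflect_chart [simp]: "snd (reflect_chart a c) = reflection a \<circ> snd c"
  by (simp add: reflect_chart_def)

lemma inv_reflect_chart: "inv_chart (reflect_chart a c) = inv_chart c \<circ> reflection a"
  by (auto simp: inv_into_def reflection_eq_iff fun_eq_iff)

lemma is_chart_reflect_chart:
  assumes "is_chart M c"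
  shows "is_chart M (reflect_chart a c)"
proof -
  let ?S = "snd c ` fst c"
  have cont: "continuous_on T (reflection a)" for T
    by (intro linear_continuous_on bounded_linear_reflection)
  have "homeomorphic_maps (top_of_set ?S) (top_of_set (reflection a ` ?S)) (reflection a) (reflection a)"
    unfolding homeomorphic_maps_def using cont by (auto simp: continuous_map_in_subtopology)
  then have "homeomorphic_map (top_of_set ?S) (top_of_set (reflection a ` ?S)) (reflection a)"
    by (rule homeomorphic_maps_imp_map)
  moreover have "homeomorphic_map (subtopology M (fst c)) (top_of_set ?S) (snd c)"
    using assms by (simp add: is_chart_def)
  ultimately have "homeomorphic_map (subtopology M (fst c)) (top_of_set (reflection a ` ?S)) (reflection a \<circ> snd c)"
    using homeomorphic_map_compose by blast
  moreover have "open (reflection a ` ?S)" "openin M (fst c)"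
    using assms open_reflection_image unfolding is_chart_def by auto
  ultimately show ?thesis by (simp add: is_chart_def image_comp)
qed

lemma reflect_chart_in_charts:
  assumes M: "smooth_manifold M A" and c: "c \<in> charts M A"
  shows "reflect_chart a c \<in> charts M A"
proof -
  have "compatible (reflect_chart a c) d" if d: "d \<in> A" for d
  proof -
    have dc: "is_chart M d" using M d unfolding smooth_manifold_def by blast
    have cd: "smooth_on (snd c ` (fst c \<inter> fst d)) (snd d \<circ> inv_chart c)"
      and dc': "smooth_on (snd d ` (fst c \<inter> fst d)) (snd c \<circ> inv_chart d)"
      using c d unfolding charts_def compatible_def by auto
    have o: "open (snd c ` (fst c \<inter> fst d))"
      using is_chart_open_overlap[OF charts_is_chart[OF c] dc] .
    have o': "open (snd d ` (fst c \<inter> fst d))"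
      using is_chart_open_overlap[OF dc charts_is_chart[OF c]] by (simp add: inf_commute)
    have "smooth_on (reflection a ` snd c ` (fst c \<inter> fst d)) (\<lambda>p. (snd d \<circ> inv_chart c) (reflection a p))"
      by (rule smooth_on_compose[OF open_reflection_image[OF o] o _ cd])
        (auto intro: smooth_on_linear[OF bounded_linear_reflection open_reflection_image[OF o]])
    moreover have "smooth_on (snd d ` (fst c \<inter> fst d)) (\<lambda>p. reflection a ((snd c \<circ> inv_chart d) p))"
      by (rule smooth_on_bounded_linear[OF bounded_linear_reflection o' dc'])
    ultimately show ?thesis
      unfolding compatible_def inv_reflect_chart
      by (simp only: snd_reflect_chart fst_reflect_chart image_comp[symmetric]) (simp add: comp_def)
  qed
  then show ?thesis
    using is_chart_reflect_chart[OF charts_is_chart[OF c]] by (simp add: charts_def)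
qed

lemma smooth_in_reflect_chart:
  assumes c: "coordinate_chart c" and f: "smooth_in_chart c f"
  shows "smooth_in_chart (reflect_chart a c) f"
proof -
  have o: "open (snd c ` fst c)" using c by (simp add: coordinate_chart_def)
  have "smooth_on (reflection a ` snd c ` fst c) (\<lambda>p. (f \<circ> inv_chart c) (reflection a p))"
    by (rule smooth_on_compose[OF open_reflection_image[OF o] o _ f[unfolded smooth_in_chart_def]])
      (auto intro: smooth_on_linear[OF bounded_linear_reflection open_reflection_image[OF o]])
  then show ?thesis
    unfolding smooth_in_chart_def inv_reflect_chart
    by (simp only: snd_reflect_chart fst_reflect_chart image_comp[symmetric]) (simp add: comp_def)
qed

lemma frame_deriv_reflect_chart:
  assumes c: "coordinate_chart c" and f: "smooth_in_chart c f" and u: "u \<in> fst c"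
  shows "frame_deriv (reflect_chart a c) i f u = (if i = a then - 1 else 1) *\<^sub>R frame_deriv c i f u"
proof -
  interpret c: coordinate_chart c by (rule c)
  let ?f = "f \<circ> inv_chart c"
  let ?p = "reflection a (snd c u)"
  have "(?f has_derivative frechet_derivative ?f (at (snd c u))) (at (reflection a ?p))"
    using c.differentiable_in_chart[OF f u] by (simp add: frechet_derivative_works)
  moreover have "(reflection a has_derivative reflection a) (at ?p)"
    by (rule bounded_linear_imp_has_derivative[OF bounded_linear_reflection])
  ultimately have "((?f \<circ> reflection a) has_derivative (frechet_derivative ?f (at (snd c u)) \<circ> reflection a)) (at ?p)"
    by (intro diff_chain_at)
  then have "frame_deriv (reflect_chart a c) i f u = frechet_derivative ?f (at (snd c u)) (reflection a (axis i 1))"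
    unfolding frame_deriv_def inv_reflect_chart
    by (simp only: snd_reflect_chart o_assoc comp_apply frechet_derivative_at[symmetric])
  moreover have "reflection a (axis i 1) = (if i = a then - 1 else 1) *\<^sub>R axis i 1"
    by (auto simp: reflection_def vec_eq_iff axis_def)
  ultimately show ?thesis
    using linear_cmul[OF linear_frechet_derivative[OF c.differentiable_in_chart[OF f u]]]
    by (simp add: frame_deriv_def)
qed

section \<open>Volume form, second fundamental form and Laplacian\<close>

lemma Vol_linear: "linear (Vol X)"
proof
  have row: "(\<chi> k. case k of Some i \<Rightarrow> X i | None \<Rightarrow> N) = (\<chi> k. if k = None then N else X (the k))" for N
    by (auto simp: vec_eq_iff split: option.split)
  show "Vol X (v + w) = Vol X v + Vol X w" for v w
    unfolding Vol_def row using det_row_add[of None "\<lambda>_. v" "\<lambda>_. w"] by simp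
  show "Vol X (r *\<^sub>R v) = r *\<^sub>R Vol X v" for r v
    unfolding Vol_def row using det_row_mul[of None r "\<lambda>_. v" "\<lambda>k. X (the k)"]
    unfolding scalar_mult_eq_scaleR by simp
qed

lemma Vol_tangent: "Vol X (X i) = 0"
  unfolding Vol_def by (rule det_identical_rows[of None "Some i"]) (simp_all add: row_def)

lemma Vol_scale: "Vol (\<lambda>i. s i *\<^sub>R X i) N = (\<Prod>i\<in>UNIV. s i) * Vol X N"
proof -
  let ?t = "\<lambda>k. case k of Some i \<Rightarrow> s i | None \<Rightarrow> 1"
  have "(\<chi> k. case k of Some i \<Rightarrow> s i *\<^sub>R X i | None \<Rightarrow> N) = (\<chi> k. ?t k *s (case k of Some i \<Rightarrow> X i | None \<Rightarrow> N))"
    by (auto simp: vec_eq_iff scalar_mult_eq_scaleR split: option.split)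
  then have "Vol (\<lambda>i. s i *\<^sub>R X i) N = prod ?t UNIV * Vol X N"
    unfolding Vol_def by (simp add: det_rows_mul)
  also have "prod ?t UNIV = (\<Prod>i\<in>UNIV. s i)"
    by (simp add: UNIV_option_conv prod.reindex)
  finally show ?thesis .
qed

lemma Vol_expansion:
  assumes "Vol X N \<noteq> 0"
  obtains \<Gamma> where "w = (\<Sum>k\<in>UNIV. \<Gamma> k *\<^sub>R X k) + (Vol X w / Vol X N) *\<^sub>R N"
proof -
  let ?R = "\<chi> k. case k of Some i \<Rightarrow> X i | None \<Rightarrow> N"
  have "det (transpose ?R) \<noteq> 0" using assms by (simp add: Vol_def det_transpose)
  then have "transpose ?R *v (matrix_inv (transpose ?R) *v w) = w"
    by (simp add: matrix_vector_mul_assoc matrix_inv_works)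
  then obtain v where "transpose ?R *v v = w" by blast
  then have "w = (\<Sum>k\<in>UNIV. v $ k *s column k (transpose ?R))"
    using matrix_mult_sum[of "transpose ?R" v] by simp
  also have "\<dots> = (\<Sum>k\<in>UNIV. v $ k *\<^sub>R (case k of Some i \<Rightarrow> X i | None \<Rightarrow> N))"
    by (simp add: column_def transpose_def scalar_mult_eq_scaleR vec_eq_iff)
  also have "\<dots> = (\<Sum>k\<in>UNIV. v $ Some k *\<^sub>R X k) + v $ None *\<^sub>R N"
    by (simp add: UNIV_option_conv sum.reindex add.commute)
  finally have w: "w = (\<Sum>k\<in>UNIV. v $ Some k *\<^sub>R X k) + v $ None *\<^sub>R N" .
  then have "Vol X w = v $ None * Vol X N"
    by (simp add: linear_add[OF Vol_linear] linear_sum[OF Vol_linear] linear_cmul[OF Vol_linear] Vol_tangent)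
  then have "v $ None = Vol X w / Vol X N" using assms by simp
  with w show thesis by (intro that[of "\<lambda>k. v $ Some k"]) simp
qed

definition conormal ::
    "('a, 'n::finite) chart \<Rightarrow> ('a \<Rightarrow> real^('n option)) \<Rightarrow> 'a \<Rightarrow> real^('n option)" where
  "conormal c x u = (\<chi> k. Vol (\<lambda>i. frame_deriv c i x u) (axis k 1))"

lemma conormal_inner: "conormal c x u \<bullet> w = Vol (\<lambda>i. frame_deriv c i x u) w"
proof -
  have "w = (\<Sum>k\<in>UNIV. w $ k *\<^sub>R axis k (1::real))"
    by (simp add: vec_eq_iff axis_def if_distrib cong: if_cong)
  then have "Vol (\<lambda>i. frame_deriv c i x u) w =
      Vol (\<lambda>i. frame_deriv c i x u) (\<Sum>k\<in>UNIV. w $ k *\<^sub>R axis k (1::real))"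
    by simp
  also have "\<dots> = conormal c x u \<bullet> w"
    by (simp add: linear_sum[OF Vol_linear] linear_cmul[OF Vol_linear] conormal_def inner_vec_def mult.commute)
  finally show ?thesis by simp
qed

lemma conormal_tangent [simp]: "conormal c x u \<bullet> frame_deriv c i x u = 0"
  unfolding conormal_inner by (rule Vol_tangent)

lemma second_form_conormal:
  assumes "unimodular_field x c N" "u \<in> fst c"
  shows "second_form x c N u $ i $ j = conormal c x u \<bullet> frame_deriv c j (frame_deriv c i x) u"
proof -
  let ?X = "\<lambda>i. frame_deriv c i x u" and ?w = "frame_deriv c j (frame_deriv c i x) u"
  have N: "Vol ?X (N u) = 1" using assms by (simp add: unimodular_field_def)
  have "(THE h. \<exists>\<Gamma>. ?w = (\<Sum>k\<in>UNIV. \<Gamma> k *\<^sub>R ?X k) + h *\<^sub>R N u) = Vol ?X ?w"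
  proof (rule the_equality)
    obtain \<Gamma> where "?w = (\<Sum>k\<in>UNIV. \<Gamma> k *\<^sub>R ?X k) + (Vol ?X ?w / Vol ?X (N u)) *\<^sub>R N u"
      by (rule Vol_expansion[of ?X "N u" ?w]) (simp_all add: N)
    then show "\<exists>\<Gamma>. ?w = (\<Sum>k\<in>UNIV. \<Gamma> k *\<^sub>R ?X k) + Vol ?X ?w *\<^sub>R N u" by (auto simp: N)
  next
    fix h assume "\<exists>\<Gamma>. ?w = (\<Sum>k\<in>UNIV. \<Gamma> k *\<^sub>R ?X k) + h *\<^sub>R N u"
    then obtain \<Gamma> where w: "?w = (\<Sum>k\<in>UNIV. \<Gamma> k *\<^sub>R ?X k) + h *\<^sub>R N u" by blast
    have "Vol ?X ((\<Sum>k\<in>UNIV. \<Gamma> k *\<^sub>R ?X k) + h *\<^sub>R N u) = h"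
      by (simp add: linear_add[OF Vol_linear] linear_sum[OF Vol_linear] linear_cmul[OF Vol_linear] N Vol_tangent[of ?X])
    then show "h = Vol ?X ?w" unfolding w[symmetric] ..
  qed
  then show ?thesis by (simp add: second_form_def conormal_inner)
qed

context coordinate_chart
begin

lemma smooth_conormal:
  assumes "smooth_in_chart c x"
  shows "smooth_in_chart c (conormal c x)"
  unfolding smooth_in_chart_def
proof (rule smooth_on_vec[OF open_image])
  fix k
  have x: "smooth_on S (\<lambda>p. frame_deriv c i x (inv_chart c p))" for i
    using smooth_frame_deriv[OF assms, of i] by (simp add: smooth_in_chart_def comp_def)
  have "smooth_on S (\<lambda>p. det (\<chi> l. case l of Some i \<Rightarrow> frame_deriv c i x (inv_chart c p) | None \<Rightarrow> axis k 1))"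
  proof (rule smooth_on_det[OF open_image])
    fix l m
    show "smooth_on S (\<lambda>p. (\<chi> l. case l of Some i \<Rightarrow> frame_deriv c i x (inv_chart c p) | None \<Rightarrow> axis k 1) $ l $ m)"
      by (cases l) (simp_all add: smooth_on_const smooth_on_vec_nth[OF open_image x])
  qed
  then show "smooth_on S (\<lambda>p. (conormal c x \<circ> inv_chart c) p $ k)"
    by (simp add: conormal_def Vol_def)
qed

lemma smooth_second_form:
  assumes "smooth_in_chart c x" "unimodular_field x c N"
  shows "smooth_in_chart c (\<lambda>u. second_form x c N u $ i $ j)"
proof (rule smooth_in_chart_cong)
  show "conormal c x u \<bullet> frame_deriv c j (frame_deriv c i x) u = second_form x c N u $ i $ j" if "u \<in> fst c" for u
    using second_form_conormal[OF assms(2) that] by simp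
  show "smooth_in_chart c (\<lambda>u. conormal c x u \<bullet> frame_deriv c j (frame_deriv c i x) u)"
    using smooth_on_inner[OF open_image smooth_conormal[OF assms(1), unfolded smooth_in_chart_def]
        smooth_frame_deriv[OF smooth_frame_deriv[OF assms(1)], unfolded smooth_in_chart_def]]
    by (simp add: smooth_in_chart_def comp_def)
qed

lemma second_form_symmetric:
  assumes "smooth_in_chart c x" "unimodular_field x c N" "u \<in> fst c"
  shows "transpose (second_form x c N u) = second_form x c N u"
proof -
  have "second_form x c N u $ i $ j = second_form x c N u $ j $ i" for i j
    by (simp only: second_form_conormal[OF assms(2,3)] frame_deriv_commute[OF assms(1,3), of i j])
  then show ?thesis by (simp add: vec_eq_iff transpose_def)
qed

lemma smooth_det_in_chart:
  "(\<And>i j. smooth_in_chart c (\<lambda>u. G u $ i $ j)) \<Longrightarrow> smooth_in_chart c (\<lambda>u. det (G u :: real^'n^'n))"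
  using smooth_on_det[OF open_image, of "\<lambda>p. G (inv_chart c p)"] by (simp add: smooth_in_chart_def comp_def)

lemma smooth_powr_in_chart:
  assumes "smooth_in_chart c f" "\<And>u. u \<in> fst c \<Longrightarrow> f u > (0::real)"
  shows "smooth_in_chart c (\<lambda>u. f u powr a)"
proof -
  have "f (inv_chart c p) > 0" if "p \<in> S" for p using that assms(2) by auto
  then show ?thesis
    using smooth_on_powr[OF open_image, of "f \<circ> inv_chart c" a] assms(1)
    by (simp add: smooth_in_chart_def comp_def)
qed

lemma smooth_mult_in_chart:
  "smooth_in_chart c f \<Longrightarrow> smooth_in_chart c g \<Longrightarrow> smooth_in_chart c (\<lambda>u. f u * (g u :: real))"
  using smooth_on_mult[OF open_image, of "f \<circ> inv_chart c" "g \<circ> inv_chart c"]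
  by (simp add: smooth_in_chart_def comp_def)

lemma smooth_scaleR_in_chart:
  "smooth_in_chart c f \<Longrightarrow> smooth_in_chart c g \<Longrightarrow> smooth_in_chart c (\<lambda>u. f u *\<^sub>R (g u :: 'w::euclidean_space))"
  using smooth_on_scaleR[OF open_image, of "f \<circ> inv_chart c" "g \<circ> inv_chart c"]
  by (simp add: smooth_in_chart_def comp_def)

lemma smooth_sum_in_chart:
  "(\<And>i. i \<in> I \<Longrightarrow> smooth_in_chart c (f i)) \<Longrightarrow> smooth_in_chart c (\<lambda>u. \<Sum>i\<in>I. (f i u :: 'w::euclidean_space))"
  using smooth_on_sum[OF open_image, of I "\<lambda>i. f i \<circ> inv_chart c"]
  by (simp add: smooth_in_chart_def comp_def)

lemma smooth_const_in_chart: "smooth_in_chart c (\<lambda>u. k)"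
  by (simp add: smooth_in_chart_def comp_def smooth_on_const)

lemma smooth_sqrt_det:
  fixes G :: "'a \<Rightarrow> real^'n^'n"
  assumes "\<And>i j. smooth_in_chart c (\<lambda>u. G u $ i $ j)" "\<And>u. u \<in> fst c \<Longrightarrow> det (G u) > 0"
  shows "smooth_in_chart c (\<lambda>u. sqrt (det (G u)))"
proof (rule smooth_in_chart_cong)
  show "det (G u) powr (1 / 2) = sqrt (det (G u))" if "u \<in> fst c" for u
    using assms(2)[OF that] by (simp add: powr_half_sqrt)
  show "smooth_in_chart c (\<lambda>u. det (G u) powr (1 / 2))"
    by (intro smooth_powr_in_chart smooth_det_in_chart assms)
qed

lemma smooth_matrix_inv:
  fixes G :: "'a \<Rightarrow> real^'n^'n"
  assumes G: "\<And>i j. smooth_in_chart c (\<lambda>u. G u $ i $ j)" and det: "\<And>u. u \<in> fst c \<Longrightarrow> det (G u) > 0"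
  shows "smooth_in_chart c (\<lambda>u. matrix_inv (G u) $ i $ j)"
proof (rule smooth_in_chart_cong)
  let ?D = "\<lambda>u. det (\<chi> r s. if s = i then axis j 1 $ r else G u $ r $ s)"
  show "?D u * det (G u) powr (- 1) = matrix_inv (G u) $ i $ j" if "u \<in> fst c" for u
    using det[OF that] matrix_inv_cramer[of "G u" i j] by (simp add: powr_minus divide_inverse)
  have "smooth_in_chart c (\<lambda>u. (\<chi> r s. if s = i then axis j 1 $ r else G u $ r $ s) $ r $ s)" for r s
    by (cases "s = i") (simp_all add: G smooth_const_in_chart)
  then show "smooth_in_chart c (\<lambda>u. ?D u * det (G u) powr (- 1))"
    by (intro smooth_mult_in_chart smooth_powr_in_chart smooth_det_in_chart G det)
qed

lemma smooth_gradient: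
  fixes f :: "'a \<Rightarrow> 'w::euclidean_space" and G :: "'a \<Rightarrow> real^'n^'n"
  assumes "\<And>i j. smooth_in_chart c (\<lambda>u. G u $ i $ j)" "\<And>u. u \<in> fst c \<Longrightarrow> det (G u) > 0" "smooth_in_chart c f"
  shows "smooth_in_chart c
    (\<lambda>w. sqrt (det (G w)) *\<^sub>R (\<Sum>j\<in>UNIV. (matrix_inv (G w) $ i $ j) *\<^sub>R frame_deriv c j f w))"
  using assms
  by (intro smooth_scaleR_in_chart smooth_sum_in_chart smooth_sqrt_det smooth_matrix_inv smooth_frame_deriv)

lemma smooth_laplacian:
  fixes f :: "'a \<Rightarrow> 'w::euclidean_space" and G :: "'a \<Rightarrow> real^'n^'n"
  assumes G: "\<And>i j. smooth_in_chart c (\<lambda>u. G u $ i $ j)" and det: "\<And>u. u \<in> fst c \<Longrightarrow> det (G u) > 0"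
    and f: "smooth_in_chart c f"
  shows "smooth_in_chart c (laplacian c G f)"
proof -
  have "smooth_in_chart c (\<lambda>u. 1 / sqrt (det (G u)))"
  proof (rule smooth_in_chart_cong)
    show "sqrt (det (G u)) powr (- 1) = 1 / sqrt (det (G u))" if "u \<in> fst c" for u
      using det[OF that] by (simp add: powr_minus divide_inverse)
    show "smooth_in_chart c (\<lambda>u. sqrt (det (G u)) powr (- 1))"
      by (intro smooth_powr_in_chart smooth_sqrt_det G det) (simp_all add: det)
  qed
  then show ?thesis
    unfolding laplacian_def
    by (intro smooth_scaleR_in_chart smooth_sum_in_chart smooth_frame_deriv smooth_gradient G det f)
qed

lemma laplacian_homothety:
  fixes f f' :: "'a \<Rightarrow> 'w::euclidean_space" and G G' :: "'a \<Rightarrow> real^'n^'n"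
  assumes G: "\<And>i j. smooth_in_chart c (\<lambda>u. G u $ i $ j)" and det: "\<And>u. u \<in> fst c \<Longrightarrow> det (G u) > 0"
    and f: "smooth_in_chart c f"
    and G': "\<And>w. w \<in> fst c \<Longrightarrow> G' w = a *\<^sub>R G w" and a: "a > 0"
    and f': "\<And>w j. w \<in> fst c \<Longrightarrow> frame_deriv c j f' w = s *\<^sub>R frame_deriv c j f w"
    and u: "u \<in> fst c"
  shows "laplacian c G' f' u = (s / a) *\<^sub>R laplacian c G f u"
proof -
  let ?F = "\<lambda>i w. sqrt (det (G w)) *\<^sub>R (\<Sum>j\<in>UNIV. (matrix_inv (G w) $ i $ j) *\<^sub>R frame_deriv c j f w)"
  let ?F' = "\<lambda>i w. sqrt (det (G' w)) *\<^sub>R (\<Sum>j\<in>UNIV. (matrix_inv (G' w) $ i $ j) *\<^sub>R frame_deriv c j f' w)"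
  let ?q = "sqrt (a ^ CARD('n))"
  have q: "?q > 0" using a by simp
  have sq: "sqrt (det (G' w)) = ?q * sqrt (det (G w))" if "w \<in> fst c" for w
    by (simp add: G'[OF that] det_scaleR real_sqrt_mult)
  have "?F' i w = (?q * (s / a)) *\<^sub>R ?F i w" if "w \<in> fst c" for i w
  proof -
    have "matrix_inv (G' w) $ i $ j = (1 / a) * matrix_inv (G w) $ i $ j" for j
      using matrix_inv_scaleR[of "G w" a] det[OF that] a by (simp add: G'[OF that])
    then show ?thesis
      by (simp add: sq[OF that] f'[OF that] scaleR_sum_right mult_ac)
  qed
  then have "frame_deriv c i (?F' i) u = frame_deriv c i (\<lambda>w. (?q * (s / a)) *\<^sub>R ?F i w) u" for i
    by (intro frame_deriv_cong u)
  then have "frame_deriv c i (?F' i) u = (?q * (s / a)) *\<^sub>R frame_deriv c i (?F i) u" for i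
    using frame_deriv_scaleR[OF smooth_gradient[OF G det f] u, of i "?q * (s / a)"] by (rule trans)
  then have "laplacian c G' f' u = (1 / (?q * sqrt (det (G u)))) *\<^sub>R (\<Sum>i\<in>UNIV. (?q * (s / a)) *\<^sub>R frame_deriv c i (?F i) u)"
    unfolding laplacian_def by (simp add: sq[OF u])
  also have "\<dots> = (s / a) *\<^sub>R laplacian c G f u"
    using q by (simp add: laplacian_def scaleR_sum_right[symmetric])
  finally show ?thesis .
qed

lemma det_blaschke_metric_pos:
  assumes "pos_def (second_form x c N u)"
  shows "det (blaschke_metric x c N u) > 0"
  using pos_def_det_pos[OF assms] by (simp add: blaschke_metric_def det_scaleR)

lemma smooth_blaschke_metric:
  assumes "smooth_in_chart c x" "unimodular_field x c N" "\<And>u. u \<in> fst c \<Longrightarrow> pos_def (second_form x c N u)"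
  shows "smooth_in_chart c (\<lambda>u. blaschke_metric x c N u $ i $ j)"
proof (rule smooth_in_chart_cong)
  let ?e = "- 1 / (real CARD('n) + 2)"
  have pos: "det (second_form x c N u) > 0" if "u \<in> fst c" for u
    using pos_def_det_pos[OF assms(3)[OF that]] .
  show "det (second_form x c N u) powr ?e * second_form x c N u $ i $ j = blaschke_metric x c N u $ i $ j"
    if "u \<in> fst c" for u
    using pos[OF that] by (simp add: blaschke_metric_def)
  show "smooth_in_chart c (\<lambda>u. det (second_form x c N u) powr ?e * second_form x c N u $ i $ j)"
    by (intro smooth_mult_in_chart smooth_powr_in_chart smooth_det_in_chart smooth_second_form assms(1,2) pos)
qed

lemma conormal_homothety:
  assumes "\<And>j. frame_deriv c j x' u = s *\<^sub>R frame_deriv c j x u"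
  shows "conormal c x' u = s ^ CARD('n) *\<^sub>R conormal c x u"
  by (simp add: conormal_def assms vec_eq_iff Vol_scale[of "\<lambda>_::'n. s"])

lemma unimodular_field_homothety:
  assumes N: "unimodular_field x c N" and s: "s \<noteq> 0"
    and x': "\<And>w j. w \<in> fst c \<Longrightarrow> frame_deriv c j x' w = s *\<^sub>R frame_deriv c j x w"
  shows "unimodular_field x' c (\<lambda>u. (1 / s ^ CARD('n)) *\<^sub>R N u)"
  unfolding unimodular_field_def
proof (intro conjI ballI)
  show "smooth_in_chart c (\<lambda>u. (1 / s ^ CARD('n)) *\<^sub>R N u)"
    using N by (intro smooth_scaleR_in_chart smooth_const_in_chart) (simp add: unimodular_field_def)
  show "Vol (\<lambda>i. frame_deriv c i x' u) ((1 / s ^ CARD('n)) *\<^sub>R N u) = 1" if "u \<in> fst c" for u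
    using N that s
    by (simp add: x'[OF that] linear_cmul[OF Vol_linear] unimodular_field_def Vol_scale[of "\<lambda>_::'n. s"])
qed

lemma second_form_homothety:
  assumes x: "smooth_in_chart c x" and N: "unimodular_field x c N" and N': "unimodular_field x' c N'"
    and x': "\<And>w j. w \<in> fst c \<Longrightarrow> frame_deriv c j x' w = s *\<^sub>R frame_deriv c j x w"
    and u: "u \<in> fst c"
  shows "second_form x' c N' u = s ^ (CARD('n) + 1) *\<^sub>R second_form x c N u"
proof -
  have "frame_deriv c j (frame_deriv c i x') u = s *\<^sub>R frame_deriv c j (frame_deriv c i x) u" for i j
  proof -
    have "frame_deriv c j (frame_deriv c i x') u = frame_deriv c j (\<lambda>w. s *\<^sub>R frame_deriv c i x w) u"
      by (rule frame_deriv_cong[OF x' u])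
    then show ?thesis using frame_deriv_scaleR[OF smooth_frame_deriv[OF x] u] by simp
  qed
  then have "second_form x' c N' u $ i $ j = s ^ (CARD('n) + 1) * second_form x c N u $ i $ j" for i j
    by (simp add: second_form_conormal[OF N u] second_form_conormal[OF N' u]
        conormal_homothety[where x = x and s = s, OF x'[OF u]])
  then show ?thesis by (simp add: vec_eq_iff)
qed

lemma blaschke_metric_homothety:
  assumes "smooth_in_chart c x" "unimodular_field x c N" "unimodular_field x' c N'"
    and "\<And>w j. w \<in> fst c \<Longrightarrow> frame_deriv c j x' w = s *\<^sub>R frame_deriv c j x w" and "u \<in> fst c"
  shows "blaschke_metric x' c N' u =
    (\<bar>(s ^ (CARD('n) + 1)) ^ CARD('n)\<bar> powr (- 1 / (real CARD('n) + 2)) * s ^ (CARD('n) + 1)) *\<^sub>R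
      blaschke_metric x c N u"
  by (simp only: blaschke_metric_def second_form_homothety[OF assms] det_scaleR abs_mult powr_mult abs_ge_zero
      scaleR_scaleR mult_ac)

end

lemma pos_def_scaleR: "a > 0 \<Longrightarrow> pos_def (a *\<^sub>R Q) \<longleftrightarrow> pos_def Q"
  by (simp add: pos_def_def scaleR_matrix_vector_assoc[symmetric] zero_less_mult_iff)

section \<open>Umbilicity of the normal field\<close>

lemma sum_scaleR_mat:
  fixes f :: "'n::finite \<Rightarrow> 'w::real_vector"
  shows "(\<Sum>j\<in>UNIV. (k *\<^sub>R mat 1 :: real^'n^'n) $ i $ j *\<^sub>R f j) = k *\<^sub>R f i"
proof -
  have "(\<Sum>j\<in>UNIV. (k *\<^sub>R mat 1 :: real^'n^'n) $ i $ j *\<^sub>R f j) = (\<Sum>j\<in>UNIV. if i = j then k *\<^sub>R f i else 0)"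
    by (rule sum.cong) (auto simp: mat_def)
  then show ?thesis by simp
qed

context coordinate_chart
begin

lemma umbilic_of_single_curvature:
  assumes x: "smooth_in_chart c x" and N: "unimodular_field x c N"
    and pos: "\<And>u. u \<in> fst c \<Longrightarrow> pos_def (second_form x c N u)"
    and Y: "smooth_in_chart c Y"
    and curv: "\<And>u. u \<in> fst c \<Longrightarrow> principal_curvatures c x Y u = {\<kappa>}"
    and u: "u \<in> fst c"
  shows "frame_deriv c i Y u = - \<kappa> *\<^sub>R frame_deriv c i x u"
proof -
  have shape: "\<exists>B. shape_operator c x Y w B" if "w \<in> fst c" for w
    using curv[OF that] unfolding principal_curvatures_def by blast
  have normal: "conormal c x w \<bullet> frame_deriv c i Y w = 0" if w: "w \<in> fst c" for w i
  proof -
    obtain B where "shape_operator c x Y w B" using shape[OF w] by blast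
    then show ?thesis
      unfolding shape_operator_def by (simp add: inner_sum_right)
  qed
  obtain B where B: "shape_operator c x Y u B" using shape[OF u] by blast
  let ?h = "second_form x c N u"
  have product_rule: "conormal c x u \<bullet> frame_deriv c j (frame_deriv c i f) u =
      - (frame_deriv c j (conormal c x) u \<bullet> frame_deriv c i f u)"
    if f: "smooth_in_chart c f" and zero: "\<And>w. w \<in> fst c \<Longrightarrow> conormal c x w \<bullet> frame_deriv c i f w = 0"
    for f i j
  proof -
    have "frame_deriv c j (\<lambda>w. conormal c x w \<bullet> frame_deriv c i f w) u = frame_deriv c j (\<lambda>w. 0) u"
      by (rule frame_deriv_cong[OF zero u])
    then show ?thesis
      using frame_deriv_inner[OF smooth_conormal[OF x] smooth_frame_deriv[OF f] u, of j i]
      by (simp add: frame_deriv_const)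
  qed
  have hess: "conormal c x u \<bullet> frame_deriv c j (frame_deriv c i Y) u = - (B ** ?h) $ i $ j" for i j
  proof -
    have "conormal c x u \<bullet> frame_deriv c j (frame_deriv c i Y) u =
        - (frame_deriv c j (conormal c x) u \<bullet> frame_deriv c i Y u)"
      by (rule product_rule[OF Y normal])
    also have "\<dots> = (\<Sum>k\<in>UNIV. B $ i $ k * (frame_deriv c j (conormal c x) u \<bullet> frame_deriv c k x u))"
      using B by (simp add: shape_operator_def inner_sum_right)
    also have "\<dots> = (\<Sum>k\<in>UNIV. B $ i $ k * - ?h $ k $ j)"
      using product_rule[OF x conormal_tangent, of j]
      by (simp add: second_form_conormal[OF N u])
    also have "\<dots> = - (B ** ?h) $ i $ j"
      by (simp add: matrix_matrix_mult_def sum_negf)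
    finally show ?thesis .
  qed
  have "(B ** ?h) $ i $ j = (B ** ?h) $ j $ i" for i j
    using hess[of i j] hess[of j i] frame_deriv_commute[OF Y u, of i j] by simp
  then have "transpose (B ** ?h) = B ** ?h"
    by (simp add: transpose_def vec_eq_iff)
  moreover have "t = \<kappa>" if "v \<noteq> 0" "B *v v = t *\<^sub>R v" for t v
    using curv[OF u] B that unfolding principal_curvatures_def by blast
  ultimately have "B = \<kappa> *\<^sub>R mat 1"
    using self_adjoint_single_eigenvalue[OF pos[OF u] second_form_symmetric[OF x N u]] by blast
  then show ?thesis
    using B unfolding shape_operator_def by (simp only: sum_scaleR_mat scaleR_minus_left)
qed

lemma principal_curvatures_umbilic:
  assumes inj: "inj (frechet_derivative (x \<circ> inv_chart c) (at (snd c u)))"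
    and x: "smooth_in_chart c x" and u: "u \<in> fst c"
    and Y: "\<And>i. frame_deriv c i Y u = - k *\<^sub>R frame_deriv c i x u"
  shows "principal_curvatures c x Y u = {k}"
proof -
  have "B = k *\<^sub>R mat 1" if B: "shape_operator c x Y u B" for B
  proof -
    have "B $ i $ j = (k *\<^sub>R mat 1) $ i $ j" for i j
    proof -
      let ?D = "frechet_derivative (x \<circ> inv_chart c) (at (snd c u))"
      note diff = differentiable_in_chart[OF x u]
      have "?D (B $ i) = (\<Sum>j\<in>UNIV. B $ i $ j *\<^sub>R frame_deriv c j x u)"
        by (rule frechet_derivative_frame[OF diff])
      also have "\<dots> = - frame_deriv c i Y u"
        using B unfolding shape_operator_def by simp
      also have "\<dots> = k *\<^sub>R frame_deriv c i x u"
        by (simp add: Y)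
      also have "\<dots> = ?D (k *\<^sub>R axis i 1)"
        by (simp add: frame_deriv_def linear_cmul[OF linear_frechet_derivative[OF diff]])
      finally have "B $ i = k *\<^sub>R axis i 1" using inj by (simp add: inj_eq)
      then show ?thesis by (simp add: mat_def axis_def)
    qed
    then show ?thesis by (simp add: vec_eq_iff)
  qed
  moreover have "shape_operator c x Y u (k *\<^sub>R mat 1)"
    unfolding shape_operator_def sum_scaleR_mat Y by simp
  ultimately have "shape_operator c x Y u B \<longleftrightarrow> B = k *\<^sub>R mat 1" for B
    by blast
  moreover have "(k *\<^sub>R mat 1) *v v = k *\<^sub>R v" for v :: "real^'n"
    by (simp add: scaleR_matrix_vector_assoc[symmetric])
  moreover have "axis undefined 1 \<noteq> (0::real^'n)" by (simp add: axis_eq_0_iff)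
  ultimately show ?thesis by (auto simp: principal_curvatures_def)
qed

end

lemma lsc_smooth: "locally_strongly_convex M A x \<Longrightarrow> c \<in> charts M A \<Longrightarrow> smooth_in_chart c x"
  by (simp add: locally_strongly_convex_def hypersurface_def smooth_map_def)

text \<open>Reversing one coordinate changes the sign of the second fundamental form, so the orientation
  can always be chosen as required.\<close>

lemma oriented_frame_exists:
  fixes A :: "('a, 'n::finite) chart set"
  assumes M: "smooth_manifold M A" and x: "locally_strongly_convex M A x" and u: "u \<in> topspace M"
  obtains c N where "oriented_frame M A x c N" "u \<in> fst c"
proof -
  obtain c N where c: "c \<in> charts M A" "u \<in> fst c" and N: "unimodular_field x c N"
    and definite: "(\<forall>w \<in> fst c. pos_def (second_form x c N w)) \<or> (\<forall>w \<in> fst c. pos_def (- second_form x c N w))"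
    using x u unfolding locally_strongly_convex_def by blast
  from definite show thesis
  proof
    assume "\<forall>w \<in> fst c. pos_def (second_form x c N w)"
    then show thesis using c N by (intro that) (auto simp: oriented_frame_def)
  next
    assume neg: "\<forall>w \<in> fst c. pos_def (- second_form x c N w)"
    interpret coordinate_chart c using c(1) by (rule charts_coordinate_chart)
    have sx: "smooth_in_chart c x" using lsc_smooth[OF x c(1)] .
    define a :: 'n where "a = undefined"
    define s :: "'n \<Rightarrow> real" where "s i = (if i = a then - 1 else 1)" for i
    let ?c = "reflect_chart a c"
    have prod_s: "(\<Prod>i\<in>UNIV. s i) = - 1"
      by (simp add: s_def prod.delta)
    have X: "frame_deriv ?c i f w = s i *\<^sub>R frame_deriv c i f w"
      if "smooth_in_chart c f" "w \<in> fst c" for i w and f :: "'a \<Rightarrow> real^('n option)"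
      using frame_deriv_reflect_chart[OF coordinate_chart_axioms that] by (simp add: s_def)
    have c': "?c \<in> charts M A" using reflect_chart_in_charts[OF M c(1)] .
    interpret c': coordinate_chart ?c using c' by (rule charts_coordinate_chart)
    have N': "unimodular_field x ?c (\<lambda>w. - N w)"
      unfolding unimodular_field_def
    proof (intro conjI ballI)
      have "smooth_in_chart c (\<lambda>w. (- 1) *\<^sub>R N w)"
        using N by (intro smooth_scaleR_in_chart smooth_const_in_chart) (simp add: unimodular_field_def)
      then show "smooth_in_chart ?c (\<lambda>w. - N w)"
        using smooth_in_reflect_chart[OF coordinate_chart_axioms] by simp
      show "Vol (\<lambda>i. frame_deriv ?c i x w) (- N w) = 1" if "w \<in> fst ?c" for w
        using that N by (simp add: X[OF sx] Vol_scale prod_s linear_neg[OF Vol_linear] unimodular_field_def)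
    qed
    have "pos_def (second_form x ?c (\<lambda>w. - N w) w)" if w: "w \<in> fst c" for w
    proof -
      have nu: "conormal ?c x w = - conormal c x w"
        by (simp add: conormal_def X[OF sx w] Vol_scale prod_s vec_eq_iff)
      have "frame_deriv ?c j (frame_deriv ?c i x) w = (s j * s i) *\<^sub>R frame_deriv c j (frame_deriv c i x) w" for i j
      proof -
        have "frame_deriv ?c j (frame_deriv ?c i x) w = frame_deriv ?c j (\<lambda>w. s i *\<^sub>R frame_deriv c i x w) w"
          by (rule c'.frame_deriv_cong) (use w X[OF sx] in auto)
        also have "\<dots> = s j *\<^sub>R frame_deriv c j (\<lambda>w. s i *\<^sub>R frame_deriv c i x w) w"
          by (intro X smooth_scaleR_in_chart smooth_const_in_chart smooth_frame_deriv sx w)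
        also have "\<dots> = (s j * s i) *\<^sub>R frame_deriv c j (frame_deriv c i x) w"
          using frame_deriv_scaleR[OF smooth_frame_deriv[OF sx] w] by simp
        finally show ?thesis .
      qed
      then have h': "second_form x ?c (\<lambda>w. - N w) w $ i $ j = - (s i * s j * second_form x c N w $ i $ j)" for i j
        using second_form_conormal[OF N', of w i j] second_form_conormal[OF N w, of i j] w nu
        by (simp add: mult.commute)
      show ?thesis
        unfolding pos_def_def
      proof (intro allI impI)
        fix v :: "real^'n" assume v: "v \<noteq> 0"
        let ?r = "reflection a v"
        have r: "?r $ i = s i * v $ i" for i by (simp add: reflection_def s_def)
        have "?r \<noteq> 0" using v by (metis bounded_linear_reflection linear_0 linear_conv_bounded_linear reflection_reflection)
        then have "?r \<bullet> (- second_form x c N w *v ?r) > 0" using neg w by (simp add: pos_def_def)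
        moreover have "?r \<bullet> (- second_form x c N w *v ?r) = v \<bullet> (second_form x ?c (\<lambda>w. - N w) w *v v)"
          by (simp add: inner_vec_def matrix_vector_mult_def r h' sum_distrib_left mult_ac sum_negf)
        ultimately show "v \<bullet> (second_form x ?c (\<lambda>w. - N w) w *v v) > 0" by simp
      qed
    qed
    then show thesis using c c' N' by (intro that[of ?c "\<lambda>w. - N w"]) (auto simp: oriented_frame_def)
  qed
qed

lemma affine_normal_field_smooth:
  fixes A :: "('a, 'n::finite) chart set"
  assumes Y: "affine_normal_field M A x Y" and x: "locally_strongly_convex M A x"
    and frame: "oriented_frame M A x c N"
  shows "smooth_in_chart c Y"
proof -
  have c: "c \<in> charts M A" and N: "unimodular_field x c N"
    and pos: "\<And>u. u \<in> fst c \<Longrightarrow> pos_def (second_form x c N u)"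
    using frame by (auto simp: oriented_frame_def)
  interpret coordinate_chart c using c by (rule charts_coordinate_chart)
  note sx = lsc_smooth[OF x c]
  let ?L = "\<lambda>u. (1 / real CARD('n)) *\<^sub>R laplacian c (blaschke_metric x c N) x u"
  show ?thesis
  proof (rule smooth_in_chart_cong)
    show "?L u = Y u" if "u \<in> fst c" for u
      using Y frame that unfolding affine_normal_field_def by metis
    show "smooth_in_chart c ?L"
      by (intro smooth_scaleR_in_chart smooth_const_in_chart smooth_laplacian smooth_blaschke_metric
          sx N pos det_blaschke_metric_pos)
  qed
qed

lemma affine_hypersphere_normal_derivative:
  fixes A :: "('a, 'n::finite) chart set"
  assumes M: "smooth_manifold M A" and x: "locally_strongly_convex M A x"
    and Y: "affine_normal_field M A x Y"
    and curv: "\<And>c u. c \<in> charts M A \<Longrightarrow> u \<in> fst c \<Longrightarrow> principal_curvatures c x Y u = {\<kappa>}"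
    and c: "c \<in> charts M A" and u: "u \<in> fst c"
  shows "((Y \<circ> inv_chart c) has_derivative
    (\<lambda>v. - \<kappa> *\<^sub>R frechet_derivative (x \<circ> inv_chart c) (at (snd c u)) v)) (at (snd c u))"
proof -
  have "u \<in> topspace M"
    using charts_is_chart[OF c] u openin_subset unfolding is_chart_def by blast
  then obtain d N where frame: "oriented_frame M A x d N" and ud: "u \<in> fst d"
    using oriented_frame_exists[OF M x] by blast
  then have d: "d \<in> charts M A" and N: "unimodular_field x d N"
    and pos: "\<And>u. u \<in> fst d \<Longrightarrow> pos_def (second_form x d N u)"
    by (auto simp: oriented_frame_def)
  interpret d: coordinate_chart d using d by (rule charts_coordinate_chart)
  note sx = lsc_smooth[OF x d]
  note sY = affine_normal_field_smooth[OF Y x frame]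
  let ?Dx = "frechet_derivative (x \<circ> inv_chart d) (at (snd d u))"
  let ?T = "frechet_derivative (snd d \<circ> inv_chart c) (at (snd c u))"
  have "frame_deriv d i Y u = - \<kappa> *\<^sub>R frame_deriv d i x u" for i
    by (rule d.umbilic_of_single_curvature[OF sx N pos sY curv[OF d] ud])
  then have "frechet_derivative (Y \<circ> inv_chart d) (at (snd d u)) v = - \<kappa> *\<^sub>R ?Dx v" for v
    using d.frechet_derivative_frame[OF d.differentiable_in_chart[OF sY ud], of v]
      d.frechet_derivative_frame[OF d.differentiable_in_chart[OF sx ud], of v]
    by (simp add: scaleR_sum_right sum_negf mult.commute)
  then have eq: "frechet_derivative (Y \<circ> inv_chart d) (at (snd d u)) = (\<lambda>v. - \<kappa> *\<^sub>R ?Dx v)"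
    by (rule ext)
  have "((Y \<circ> inv_chart d) has_derivative (\<lambda>v. - \<kappa> *\<^sub>R ?Dx v)) (at (snd d u))"
    using d.differentiable_in_chart[OF sY ud] unfolding frechet_derivative_works eq .
  from frechet_derivative_change_chart[OF M c d u ud this]
  have "((Y \<circ> inv_chart c) has_derivative (\<lambda>v. - \<kappa> *\<^sub>R ?Dx (?T v))) (at (snd c u))"
    by (simp add: comp_def)
  moreover have "((x \<circ> inv_chart d) has_derivative ?Dx) (at (snd d u))"
    using d.differentiable_in_chart[OF sx ud] by (simp add: frechet_derivative_works)
  from frechet_derivative_at[OF frechet_derivative_change_chart[OF M c d u ud this]]
  have "?Dx (?T v) = frechet_derivative (x \<circ> inv_chart c) (at (snd c u)) v" for v
    by (metis comp_apply)
  ultimately show ?thesis by simp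
qed

section \<open>Parallel hypersurfaces\<close>

lemma smooth_map_of_proportional_derivative:
  fixes A :: "('a, 'n::finite) chart set"
  assumes x: "smooth_map M A x"
    and f: "\<And>c u. c \<in> charts M A \<Longrightarrow> u \<in> fst c \<Longrightarrow> ((f \<circ> inv_chart c) has_derivative
      (\<lambda>v. s *\<^sub>R frechet_derivative (x \<circ> inv_chart c) (at (snd c u)) v)) (at (snd c u))"
  shows "smooth_map M A f"
  unfolding smooth_map_def smooth_in_chart_def
proof
  fix c assume c: "c \<in> charts M A"
  interpret coordinate_chart c using c by (rule charts_coordinate_chart)
  have sx: "smooth_on S (x \<circ> inv_chart c)"
    using x c by (simp add: smooth_map_def smooth_in_chart_def)
  have "Ck_on (Suc k) S (f \<circ> inv_chart c)" for k
  proof (rule Ck_on_SucI[OF open_image])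
    show "((f \<circ> inv_chart c) has_derivative
        (\<lambda>v. s *\<^sub>R frechet_derivative (x \<circ> inv_chart c) (at p) v)) (at p)" if "p \<in> S" for p
      using that f[OF c] by auto
    show "Ck_on k S (\<lambda>p. s *\<^sub>R frechet_derivative (x \<circ> inv_chart c) (at p) v)" for v
      using smooth_on_frechet_derivative[OF sx]
      by (intro Ck_on_bounded_linear[OF bounded_linear_scaleR_right open_image]) (simp add: smooth_on_def)
  qed
  then show "smooth_on S (f \<circ> inv_chart c)"
    unfolding smooth_on_def using Ck_on_SucD by metis
qed

lemma parallel_lines:
  fixes a b v :: "'v::real_vector"
  assumes "t \<noteq> 0"
  shows "affine_parallel {a + r *\<^sub>R (t *\<^sub>R v) | r. True} {b + r *\<^sub>R v | r. True}"
  unfolding affine_parallel_def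
proof (intro exI set_eqI iffI)
  fix y assume "y \<in> {b + r *\<^sub>R v | r. True}"
  then obtain r where "y = b + r *\<^sub>R v" by blast
  then have "y = (b - a) + (a + (r / t) *\<^sub>R (t *\<^sub>R v))" using assms by simp
  then show "y \<in> (\<lambda>x. (b - a) + x) ` {a + r *\<^sub>R (t *\<^sub>R v) | r. True}" by blast
next
  fix y assume "y \<in> (\<lambda>x. (b - a) + x) ` {a + r *\<^sub>R (t *\<^sub>R v) | r. True}"
  then obtain r where "y = (b - a) + (a + r *\<^sub>R (t *\<^sub>R v))" by blast
  then have "y = b + (r * t) *\<^sub>R v" by simp
  then show "y \<in> {b + r *\<^sub>R v | r. True}" by blast
qed

lemma smooth_map_const: "smooth_map M A (\<lambda>_. k)"
  by (simp add: smooth_map_def smooth_in_chart_def comp_def smooth_on_const)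

lemma unimodular_field_homothety_inverse:
  fixes c :: "('a, 'n::finite) chart"
  assumes c: "coordinate_chart c" and N: "unimodular_field x' c N" and s: "s \<noteq> 0"
    and x': "\<And>w j. w \<in> fst c \<Longrightarrow> frame_deriv c j x' w = s *\<^sub>R frame_deriv c j x w"
  shows "unimodular_field x c (\<lambda>u. s ^ CARD('n) *\<^sub>R N u)"
proof -
  interpret coordinate_chart c by (rule c)
  have "unimodular_field x c (\<lambda>u. (1 / (1 / s) ^ CARD('n)) *\<^sub>R N u)"
    by (rule unimodular_field_homothety[OF N]) (use s x' in auto)
  then show ?thesis by (simp add: power_one_over)
qed

text \<open>The whole affine geometry of \<open>x'\<close> with \<open>dx' = s dx\<close> is that of \<open>x\<close> up to constant factors.\<close>

lemma homothetic_hypersurface: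
  fixes A :: "('a, 'n::finite) chart set"
  assumes x: "locally_strongly_convex M A x" and Y: "affine_normal_field M A x Y" and s: "s > 0"
    and x': "\<And>c u. c \<in> charts M A \<Longrightarrow> u \<in> fst c \<Longrightarrow> ((x' \<circ> inv_chart c) has_derivative
      (\<lambda>v. s *\<^sub>R frechet_derivative (x \<circ> inv_chart c) (at (snd c u)) v)) (at (snd c u))"
  shows "locally_strongly_convex M A x'"
    and "\<exists>t>0. affine_normal_field M A x' (\<lambda>u. t *\<^sub>R Y u)"
proof -
  have D: "frechet_derivative (x' \<circ> inv_chart c) (at (snd c u)) =
      (\<lambda>v. s *\<^sub>R frechet_derivative (x \<circ> inv_chart c) (at (snd c u)) v)"
    if "c \<in> charts M A" "u \<in> fst c" for c u
    using frechet_derivative_at[OF x'[OF that]] by (rule sym)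
  have frame: "frame_deriv c j x' w = s *\<^sub>R frame_deriv c j x w" if "c \<in> charts M A" "w \<in> fst c" for c w j
    by (simp add: frame_deriv_def D[OF that])
  have "smooth_map M A x" using x by (simp add: locally_strongly_convex_def hypersurface_def)
  then have "smooth_map M A x'" by (rule smooth_map_of_proportional_derivative[OF _ x'])
  moreover have "inj (frechet_derivative (x' \<circ> inv_chart c) (at (snd c u)))"
    if "c \<in> charts M A" "u \<in> fst c" for c u
  proof -
    have "inj (frechet_derivative (x \<circ> inv_chart c) (at (snd c u)))"
      using x that unfolding locally_strongly_convex_def hypersurface_def by blast
    then show ?thesis unfolding D[OF that] using s by (simp add: inj_def)
  qed
  ultimately have hyp: "hypersurface M A x'" unfolding hypersurface_def by blast
  have "\<exists>c \<in> charts M A. \<exists>N. u \<in> fst c \<and> unimodular_field x' c N \<and>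
      ((\<forall>w \<in> fst c. pos_def (second_form x' c N w)) \<or> (\<forall>w \<in> fst c. pos_def (- second_form x' c N w)))"
    if u: "u \<in> topspace M" for u
  proof -
    obtain c N where c: "c \<in> charts M A" "u \<in> fst c" and N: "unimodular_field x c N"
      and definite: "(\<forall>w \<in> fst c. pos_def (second_form x c N w)) \<or> (\<forall>w \<in> fst c. pos_def (- second_form x c N w))"
      using x u unfolding locally_strongly_convex_def by blast
    interpret coordinate_chart c using c(1) by (rule charts_coordinate_chart)
    let ?N = "\<lambda>u. (1 / s ^ CARD('n)) *\<^sub>R N u"
    have N': "unimodular_field x' c ?N"
      using s by (intro unimodular_field_homothety[OF N _ frame[OF c(1)]]) auto
    have sf: "second_form x' c ?N w = s ^ (CARD('n) + 1) *\<^sub>R second_form x c N w" if "w \<in> fst c" for w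
      by (rule second_form_homothety[OF lsc_smooth[OF x c(1)] N N' frame[OF c(1)] that])
    have "pos_def (second_form x' c ?N w) = pos_def (second_form x c N w)"
      "pos_def (- second_form x' c ?N w) = pos_def (- second_form x c N w)" if "w \<in> fst c" for w
      using s pos_def_scaleR[of "s ^ (CARD('n) + 1)" "second_form x c N w"]
        pos_def_scaleR[of "s ^ (CARD('n) + 1)" "- second_form x c N w"]
      by (simp_all only: sf[OF that] scaleR_minus_right zero_less_power)
    then show ?thesis using c N' definite by blast
  qed
  with hyp show "locally_strongly_convex M A x'" unfolding locally_strongly_convex_def by blast
  define a where "a = \<bar>(s ^ (CARD('n) + 1)) ^ CARD('n)\<bar> powr (- 1 / (real CARD('n) + 2)) * s ^ (CARD('n) + 1)"
  have a: "a > 0" using s by (simp add: a_def)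
  have "(s / a) *\<^sub>R Y u = (1 / real CARD('n)) *\<^sub>R laplacian c (blaschke_metric x' c N') x' u"
    if frame': "oriented_frame M A x' c N'" and u: "u \<in> fst c" for c N' u
  proof -
    have c: "c \<in> charts M A" and N': "unimodular_field x' c N'"
      and pos': "\<And>w. w \<in> fst c \<Longrightarrow> pos_def (second_form x' c N' w)"
      using frame' by (auto simp: oriented_frame_def)
    interpret coordinate_chart c using c by (rule charts_coordinate_chart)
    note sx = lsc_smooth[OF x c]
    let ?N = "\<lambda>u. s ^ CARD('n) *\<^sub>R N' u"
    have N: "unimodular_field x c ?N"
      using s by (intro unimodular_field_homothety_inverse[OF coordinate_chart_axioms N' _ frame[OF c]]) auto
    have pos: "pos_def (second_form x c ?N w)" if "w \<in> fst c" for w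
    proof -
      have "second_form x' c N' w = s ^ (CARD('n) + 1) *\<^sub>R second_form x c ?N w"
        by (rule second_form_homothety[OF sx N N' frame[OF c] that])
      then show ?thesis
        using pos'[OF that] s pos_def_scaleR[of "s ^ (CARD('n) + 1)" "second_form x c ?N w"]
        by (simp only: zero_less_power)
    qed
    have "oriented_frame M A x c ?N"
      using c N pos by (simp add: oriented_frame_def)
    then have Yu: "Y u = (1 / real CARD('n)) *\<^sub>R laplacian c (blaschke_metric x c ?N) x u"
      using Y u unfolding affine_normal_field_def by blast
    have "laplacian c (blaschke_metric x' c N') x' u = (s / a) *\<^sub>R laplacian c (blaschke_metric x c ?N) x u"
    proof (rule laplacian_homothety[OF _ _ sx _ a frame[OF c] u])
      show "smooth_in_chart c (\<lambda>u. blaschke_metric x c ?N u $ i $ j)" for i j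
        by (rule smooth_blaschke_metric[OF sx N pos])
      show "det (blaschke_metric x c ?N w) > 0" if "w \<in> fst c" for w
        by (rule det_blaschke_metric_pos[OF pos[OF that]])
      show "blaschke_metric x' c N' w = a *\<^sub>R blaschke_metric x c ?N w" if "w \<in> fst c" for w
        unfolding a_def by (rule blaschke_metric_homothety[OF sx N N' frame[OF c] that])
    qed
    then show ?thesis by (simp add: Yu)
  qed
  then have "affine_normal_field M A x' (\<lambda>u. (s / a) *\<^sub>R Y u)"
    by (simp add: affine_normal_field_def)
  then show "\<exists>t>0. affine_normal_field M A x' (\<lambda>u. t *\<^sub>R Y u)"
    using a s by (intro exI[of _ "s / a"]) simp
qed

lemma parallel_hypersphere:
  fixes A :: "('a, 'n::finite) chart set"
  assumes M: "smooth_manifold M A" and x: "locally_strongly_convex M A x"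
    and Y: "affine_normal_field M A x Y"
    and curv: "\<And>c u. c \<in> charts M A \<Longrightarrow> u \<in> fst c \<Longrightarrow> principal_curvatures c x Y u = {\<kappa>}"
    and s: "1 - \<mu> * \<kappa> > 0"
  shows "equiaffine_parallel_hypersurface M A x Y (\<lambda>_. \<mu>)"
    and "\<exists>r>0. affine_hypersphere_of M A (shifted x Y (\<lambda>_. \<mu>)) (r * \<kappa>)"
proof -
  let ?x' = "shifted x Y (\<lambda>_. \<mu>)" and ?s = "1 - \<mu> * \<kappa>"
  have smooth: "(x \<circ> inv_chart c) differentiable (at (snd c u))" if "c \<in> charts M A" "u \<in> fst c" for c u
    using coordinate_chart.differentiable_in_chart[OF charts_coordinate_chart lsc_smooth[OF x]] that by blast
  have dY: "((Y \<circ> inv_chart c) has_derivative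
      (\<lambda>v. - \<kappa> *\<^sub>R frechet_derivative (x \<circ> inv_chart c) (at (snd c u)) v)) (at (snd c u))"
    if "c \<in> charts M A" "u \<in> fst c" for c u
    by (rule affine_hypersphere_normal_derivative[OF M x Y _ that]) (rule curv)
  have x': "((?x' \<circ> inv_chart c) has_derivative
      (\<lambda>v. ?s *\<^sub>R frechet_derivative (x \<circ> inv_chart c) (at (snd c u)) v)) (at (snd c u))"
    if cu: "c \<in> charts M A" "u \<in> fst c" for c u
  proof -
    let ?D = "frechet_derivative (x \<circ> inv_chart c) (at (snd c u))"
    have "((x \<circ> inv_chart c) has_derivative ?D) (at (snd c u))"
      using smooth[OF cu] by (simp add: frechet_derivative_works)
    from has_derivative_add[OF this has_derivative_scaleR_right[OF dY[OF cu], of \<mu>]]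
    have "((\<lambda>p. (x \<circ> inv_chart c) p + \<mu> *\<^sub>R (Y \<circ> inv_chart c) p) has_derivative
        (\<lambda>v. ?D v + \<mu> *\<^sub>R (- \<kappa> *\<^sub>R ?D v))) (at (snd c u))" .
    moreover have "?D v + \<mu> *\<^sub>R (- \<kappa> *\<^sub>R ?D v) = ?s *\<^sub>R ?D v" for v
      by (simp add: scaleR_left_diff_distrib)
    ultimately show ?thesis by (simp add: shifted_def comp_def)
  qed
  have lsc: "locally_strongly_convex M A ?x'"
    by (rule homothetic_hypersurface(1)[OF x Y s]) (rule x')
  obtain t where t: "t > 0" and Y': "affine_normal_field M A ?x' (\<lambda>u. t *\<^sub>R Y u)"
    using homothetic_hypersurface(2)[OF x Y s, of ?x'] x' by blast
  have D: "frechet_derivative (?x' \<circ> inv_chart c) (at (snd c u)) =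
      (\<lambda>v. ?s *\<^sub>R frechet_derivative (x \<circ> inv_chart c) (at (snd c u)) v)"
    if "c \<in> charts M A" "u \<in> fst c" for c u
    using frechet_derivative_at[OF x'[OF that]] by (rule sym)
  have "tangent_image c ?x' u = tangent_image c x u" if cu: "c \<in> charts M A" "u \<in> fst c" for c u
  proof -
    let ?D = "frechet_derivative (x \<circ> inv_chart c) (at (snd c u))"
    have scale: "?D (r *\<^sub>R v) = r *\<^sub>R ?D v" for r v
      by (rule linear_cmul[OF linear_frechet_derivative[OF smooth[OF cu]]])
    have "?D v \<in> range (\<lambda>v. ?s *\<^sub>R ?D v)" for v
    proof
      show "?D v = ?s *\<^sub>R ?D ((1 / ?s) *\<^sub>R v)" using s by (simp add: scale)
    qed simp
    moreover have "?s *\<^sub>R ?D v \<in> range ?D" for v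
      by (metis rangeI scale)
    ultimately show ?thesis unfolding tangent_image_def D[OF cu] by blast
  qed
  then have "affine_parallel_hypersurface M A x Y (\<lambda>_. \<mu>)"
    using lsc by (simp add: affine_parallel_hypersurface_def smooth_map_const affine_parallel_reflex)
  moreover have "affine_parallel (affine_normal_line ?x' (\<lambda>u. t *\<^sub>R Y u) u) (affine_normal_line x Y u)" for u
    unfolding affine_normal_line_def using t by (intro parallel_lines) simp
  ultimately show "equiaffine_parallel_hypersurface M A x Y (\<lambda>_. \<mu>)"
    using Y' unfolding equiaffine_parallel_hypersurface_def by blast
  have "principal_curvatures c ?x' (\<lambda>u. t *\<^sub>R Y u) u = {(t / ?s) * \<kappa>}"
    if cu: "c \<in> charts M A" "u \<in> fst c" for c u
  proof -
    interpret coordinate_chart c using cu(1) by (rule charts_coordinate_chart)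
    show ?thesis
    proof (rule principal_curvatures_umbilic)
      show "inj (frechet_derivative (?x' \<circ> inv_chart c) (at (snd c u)))"
        using lsc cu unfolding locally_strongly_convex_def hypersurface_def by blast
      show "smooth_in_chart c ?x'" using lsc_smooth[OF lsc cu(1)] .
      show "frame_deriv c i (\<lambda>u. t *\<^sub>R Y u) u = - (t / ?s * \<kappa>) *\<^sub>R frame_deriv c i ?x' u" for i
      proof -
        have "(((\<lambda>u. t *\<^sub>R Y u) \<circ> inv_chart c) has_derivative
            (\<lambda>v. t *\<^sub>R (- \<kappa> *\<^sub>R frechet_derivative (x \<circ> inv_chart c) (at (snd c u)) v))) (at (snd c u))"
          using has_derivative_scaleR_right[OF dY[OF cu], of t] by (simp add: comp_def)
        from frechet_derivative_at[OF this, symmetric] show ?thesis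
          using s by (simp add: frame_deriv_def D[OF cu])
      qed
    qed (use cu in simp)
  qed
  then show "\<exists>r>0. affine_hypersphere_of M A ?x' (r * \<kappa>)"
    using t s lsc Y' by (intro exI[of _ "t / ?s"]) (auto simp: affine_hypersphere_of_def)
qed

theorem corollary1p4:
  fixes M :: "'a topology" and A :: "('a, 'n::finite) chart set"
    and x :: "'a \<Rightarrow> real^('n option)"
  assumes "smooth_manifold M A" and "connected_space M"
    and "locally_strongly_convex M A x"
  shows "affine_hypersphere M A x \<longleftrightarrow> in_equiaffine_parallel_family M A x"
proof
  assume "affine_hypersphere M A x"
  then obtain \<kappa> Y where Y: "affine_normal_field M A x Y"
    and curv: "\<And>c u. c \<in> charts M A \<Longrightarrow> u \<in> fst c \<Longrightarrow> principal_curvatures c x Y u = {\<kappa>}"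
    unfolding affine_hypersphere_def affine_hypersphere_of_def by blast
  define \<delta> where "\<delta> = 1 / (\<bar>\<kappa>\<bar> + 1)"
  have \<delta>: "\<delta> > 0" by (simp add: \<delta>_def add_nonneg_pos)
  have s: "1 - \<mu> * \<kappa> > 0" if "\<mu> \<in> {-\<delta><..<\<delta>}" for \<mu>
  proof -
    have "\<bar>\<mu>\<bar> * (\<bar>\<kappa>\<bar> + 1) < 1"
      using that by (auto simp: \<delta>_def pos_less_divide_eq[symmetric] add_nonneg_pos)
    then have "\<bar>\<mu> * \<kappa>\<bar> < 1" by (simp add: abs_mult distrib_left)
    then show ?thesis by linarith
  qed
  have parallel: "equiaffine_parallel_hypersurface M A x Y (\<lambda>_. \<mu>)"
      "\<exists>r>0. affine_hypersphere_of M A (shifted x Y (\<lambda>_. \<mu>)) (r * \<kappa>)" if "\<mu> \<in> {-\<delta><..<\<delta>}" for \<mu>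
    using parallel_hypersphere[OF assms(1,3) Y _ s[OF that]] curv by blast+
  have "\<forall>\<mu>\<in>{-\<delta><..<\<delta>}. equiaffine_parallel_hypersurface M A x Y (\<lambda>_. \<mu>)"
    using parallel(1) by blast
  moreover have "(\<forall>\<mu>\<in>{-\<delta><..<\<delta>}. elliptic_hypersphere M A (shifted x Y (\<lambda>_. \<mu>))) \<or>
      (\<forall>\<mu>\<in>{-\<delta><..<\<delta>}. parabolic_hypersphere M A (shifted x Y (\<lambda>_. \<mu>))) \<or>
      (\<forall>\<mu>\<in>{-\<delta><..<\<delta>}. hyperbolic_hypersphere M A (shifted x Y (\<lambda>_. \<mu>)))"
  proof -
    consider "\<kappa> > 0" | "\<kappa> = 0" | "\<kappa> < 0" by linarith
    then show ?thesis
    proof cases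
      case 1
      then show ?thesis
        using parallel(2) unfolding elliptic_hypersphere_def by (metis mult_pos_pos)
    next
      case 2
      then show ?thesis
        using parallel(2) unfolding parabolic_hypersphere_def by (metis mult_zero_right)
    next
      case 3
      then show ?thesis
        using parallel(2) unfolding hyperbolic_hypersphere_def by (metis mult_pos_neg)
    qed
  qed
  ultimately show "in_equiaffine_parallel_family M A x"
    using Y \<delta> unfolding in_equiaffine_parallel_family_def by blast
next
  assume "in_equiaffine_parallel_family M A x"
  then obtain Y \<delta> where "\<delta> > 0" and
    "(\<forall>\<mu>\<in>{-\<delta><..<\<delta>}. elliptic_hypersphere M A (shifted x Y (\<lambda>_. \<mu>))) \<or>
     (\<forall>\<mu>\<in>{-\<delta><..<\<delta>}. parabolic_hypersphere M A (shifted x Y (\<lambda>_. \<mu>))) \<or>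
     (\<forall>\<mu>\<in>{-\<delta><..<\<delta>}. hyperbolic_hypersphere M A (shifted x Y (\<lambda>_. \<mu>)))"
    unfolding in_equiaffine_parallel_family_def by blast
  moreover have "shifted x Y (\<lambda>_. 0) = x" by (simp add: shifted_def)
  moreover have "0 \<in> {-\<delta><..<\<delta>}" using \<open>\<delta> > 0\<close> by simp
  ultimately have "elliptic_hypersphere M A x \<or> parabolic_hypersphere M A x \<or> hyperbolic_hypersphere M A x"
    by metis
  then show "affine_hypersphere M A x"
    unfolding affine_hypersphere_def elliptic_hypersphere_def parabolic_hypersphere_def
      hyperbolic_hypersphere_def by blast
qed

end
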